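(* Let $0<\alpha<1/2$ and let $f\in L^2(\mathbb R^n)$ be log-concave. Then \[\frac{\alpha}{\Gamma(n+1)^{\frac{2\alpha}n}\Gamma(1-2\alpha)}\,|\Pi_2^{*,\alpha}f|^{-\frac{2\alpha}n}\le\|f\|_2^{2+\frac{4\alpha}n}\|f\|_1^{-\frac{4\alpha}n}\le\Vert f\Vert_{\frac{2n}{n-2\alpha}}^2.\] There is equality in the first inequality if $f(x)=a\,e^{-\Vert x-x_0\Vert_\Delta}$ for $x\in\mathbb R^n$, with $a\ge0$, $x_0\in\mathbb R^n$ and $\Delta$ an $n$-dimensional simplex having a vertex at the origin.
   Context: For measurable $f$ and $0<\alpha<1$, $\Pi_2^{*,\alpha}f$ is the star-shaped set whose radial function on $\mathbb S^{n-1}$ is given by $\rho_{\Pi_2^{*,\alpha}f}(\xi)^{-2\alpha}=\int_0^\infty t^{-2\alpha-1}\int_{\mathbb R^n}|f(x+t\xi)-f(x)|^2\,dx\,dt$, and $|\Pi_2^{*,\alpha}f|=\frac1n\int_{\mathbb S^{n-1}}\rho_{\Pi_2^{*,\alpha}f}(\xi)^n\,d\xi$ is its volume. $\Vert x\Vert_\Delta=\inf\{\lambda>0:x\in\lambda\Delta\}$. Log-concave means $\log f$ is concave with values in $[-\infty,\infty)$. *)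

theory Defs
  imports "HOL-Analysis.Analysis"
begin

definition log_concave :: "('a::real_vector \<Rightarrow> real) \<Rightarrow> bool" where
  "log_concave f \<longleftrightarrow> (\<forall>x. 0 \<le> f x) \<and>
     (\<forall>x y l. 0 < l \<and> l < 1 \<longrightarrow>
        f x powr (1 - l) * f y powr l \<le> f ((1 - l) *\<^sub>R x + l *\<^sub>R y))"

definition Lp_norm :: "real \<Rightarrow> ('a::euclidean_space \<Rightarrow> real) \<Rightarrow> real" where
  "Lp_norm p f = enn2real (\<integral>\<^sup>+ x. ennreal (\<bar>f x\<bar> powr p) \<partial>lebesgue) powr (1 / p)"

definition Pi_integral :: "real \<Rightarrow> ('a::euclidean_space \<Rightarrow> real) \<Rightarrow> 'a \<Rightarrow> ennreal" where
  "Pi_integral \<alpha> f \<xi> =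
     (\<integral>\<^sup>+ t. indicator {0<..} t * ennreal (t powr (-2 * \<alpha> - 1)) *
        (\<integral>\<^sup>+ x. ennreal ((f (x + t *\<^sub>R \<xi>) - f x)\<^sup>2) \<partial>lebesgue) \<partial>lebesgue)"

definition Pi_radial :: "real \<Rightarrow> ('a::euclidean_space \<Rightarrow> real) \<Rightarrow> 'a \<Rightarrow> ennreal" where
  "Pi_radial \<alpha> f \<xi> =
     (let I = Pi_integral \<alpha> f \<xi> in
      if I = 0 then \<infinity> else if I = \<infinity> then 0
      else ennreal (enn2real I powr (-1 / (2 * \<alpha>))))"

definition Pi_star :: "real \<Rightarrow> ('a::euclidean_space \<Rightarrow> real) \<Rightarrow> 'a set" where
  "Pi_star \<alpha> f = {x. x = 0 \<or> ennreal (norm x) \<le> Pi_radial \<alpha> f (x /\<^sub>R norm x)}"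

definition gauge_fn :: "'a::real_vector set \<Rightarrow> 'a \<Rightarrow> ereal" where
  "gauge_fn \<Delta> x = Inf {ereal l | l. l > 0 \<and> x \<in> (\<lambda>y. l *\<^sub>R y) ` \<Delta>}"

end

theory Submission
  imports Defs
begin

text \<open>
  Let \<open>g y\<close> be the integral of \<open>f x * f (x + y)\<close> over \<open>x\<close>. Then \<open>g 0 = \<parallel>f\<parallel>\<^sub>2\<^sup>2\<close>, the total integral of \<open>g\<close> is
  \<open>\<parallel>f\<parallel>\<^sub>1\<^sup>2\<close>, and the squared \<open>L\<^sub>2\<close> distance of \<open>f\<close> from its translate by \<open>y\<close> is \<open>2 * (g 0 - g y)\<close>. By the
  Prekopa-Leindler inequality \<open>g\<close> is log-concave, so on each ray \<open>h t = g (t \<xi>) / g 0\<close> crosses any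
  exponential \<open>exp (- c * t)\<close> at most once. Choosing \<open>c\<close> such that both have the same integral of
  \<open>t powr (- 2 * \<alpha> - 1) * (1 - h t)\<close>, the single crossing bounds the integral of \<open>t ^ (n - 1) * h t\<close>
  by that of the exponential. Integrating over all directions compares \<open>\<parallel>f\<parallel>\<^sub>1\<^sup>2\<close> with the volume of the
  polar projection body. If \<open>f\<close> is the exponential of a simplex gauge, \<open>g\<close> is exponential on every ray,
  which gives equality. The second inequality interpolates \<open>L\<^sub>2\<close> between \<open>L\<^sub>1\<close> and \<open>L\<^sub>p\<close>.
\<close>

section \<open>Prekopa-Leindler inequality\<close>

text \<open>One constant serves all directions because the rate cancels. For an exponential of rate
  c on a ray, the integral behind the radial function is proportional to c^(2\<alpha>), so the
  radial function is proportional to 1/c. Its n-th power is then proportional to c^(-n), and so is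
  the integral of t^(n-1) exp(-c t). The condition \<alpha> < 1/2 makes the integral of
  t^(-2\<alpha>-1) (1 - exp(-c t)) converge at 0. Prekopa-Leindler is applied to the products f x *
  f (x + y), whose midpoint inequality is that of f used twice. Since only midpoints are treated,
  continuity of the autocorrelation is what reaches arbitrary ratios. The function f itself may jump
  on the frontier of its support, but that frontier is null because the support is convex. Two kinds
  of rays have no matching exponential of positive rate: those with zero deficit, which lie entirely
  in the polar projection body, and those with infinite deficit, on which the autocorrelation
  vanishes. Integrals with values in the extended nonnegative reals cover both without a prior proof
  of finiteness.\<close>

lemma emeasure_lborel_shift:
  fixes S :: "'a::euclidean_space set"
  assumes [measurable]: "S \<in> sets borel"
  shows "emeasure lborel {z. z - c \<in> S} = emeasure lborel S"
proof -
  have "emeasure lborel S = emeasure (distr lborel borel ((+) (- c))) S"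
    by (simp only: lborel_distr_plus)
  also have "\<dots> = emeasure lborel {z. z - c \<in> S}"
    by (subst emeasure_distr) (auto intro!: arg_cong[where f="emeasure lborel"])
  finally show ?thesis by simp
qed

lemma nn_integral_lborel_shift:
  fixes F :: "'a::euclidean_space \<Rightarrow> ennreal"
  assumes [measurable]: "F \<in> borel_measurable borel"
  shows "(\<integral>\<^sup>+x. F (x + c) \<partial>lborel) = (\<integral>\<^sup>+x. F x \<partial>lborel)"
proof -
  have "(\<integral>\<^sup>+x. F x \<partial>lborel) = (\<integral>\<^sup>+x. F x \<partial>distr lborel borel ((+) c))"
    by (simp only: lborel_distr_plus)
  also have "\<dots> = (\<integral>\<^sup>+x. F (x + c) \<partial>lborel)"
    by (subst nn_integral_distr) (auto simp: add.commute)
  finally show ?thesis by simp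
qed

lemma integrable_lborel_shift:
  fixes h :: "'a::euclidean_space \<Rightarrow> real"
  assumes "integrable lborel h"
  shows "integrable lborel (\<lambda>x. h (x + c))"
proof -
  have "integrable (distr lborel borel ((+) c)) h" using assms by (simp only: lborel_distr_plus)
  then show ?thesis
    by (subst (asm) integrable_distr_eq) (use assms in \<open>auto simp: add.commute\<close>)
qed

lemma nn_integral_lborel_scale:
  fixes F :: "'a::euclidean_space \<Rightarrow> ennreal"
  assumes [measurable]: "F \<in> borel_measurable borel" and "c > 0"
  shows "(\<integral>\<^sup>+x. F (c *\<^sub>R x) \<partial>lborel) * ennreal (c ^ DIM('a)) = (\<integral>\<^sup>+x. F x \<partial>lborel)"
proof -
  have "(\<integral>\<^sup>+x. F x \<partial>lborel)
      = (\<integral>\<^sup>+x. F x \<partial>density (distr lborel borel (\<lambda>x. 0 + c *\<^sub>R x)) (\<lambda>_. \<bar>c\<bar>^DIM('a)))"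
    using \<open>c > 0\<close> by (subst lborel_affine[of c 0]) simp_all
  also have "\<dots> = (\<integral>\<^sup>+x. ennreal (c^DIM('a)) * F (c *\<^sub>R x) \<partial>lborel)"
    using \<open>c > 0\<close>
    by (subst nn_integral_density) (auto simp: nn_integral_distr ennreal_power)
  also have "\<dots> = (\<integral>\<^sup>+x. F (c *\<^sub>R x) \<partial>lborel) * ennreal (c ^ DIM('a))"
    by (subst nn_integral_cmult) (auto simp: mult.commute)
  finally show ?thesis by simp
qed

text \<open>Allows a set to be cut at one of its own points with arbitrarily small loss of measure,
  as the one-dimensional Brunn-Minkowski argument demands. The cut points follow a sequence that
  exhausts \<open>X\<close> from the left; the single point dropped by the strict inequality is
  null.\<close>

lemma emeasure_below_point:
  fixes X :: "real set"
  assumes [measurable]: "X \<in> sets borel" and "X \<noteq> {}"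
  shows "emeasure lborel X \<le> (SUP x\<in>X. emeasure lborel (X \<inter> {..<x}))"
proof -
  \<comment> \<open>The sequence stays below points of \<open>X\<close> and yet reaches every point
    of \<open>X\<close>: the natural numbers if \<open>X\<close> is unbounded above, a constant if
    the supremum is attained, and an approach to the supremum otherwise.\<close>
  have "\<exists>r::nat \<Rightarrow> real. incseq r \<and> (\<forall>k. \<exists>x\<in>X. r k \<le> x) \<and> (\<forall>x\<in>X. \<exists>k. x \<le> r k)"
  proof (cases "bdd_above X")
    case False
    have "incseq real" by (simp add: incseq_def)
    moreover have "\<forall>k. \<exists>x\<in>X. real k \<le> x" using False by (metis bdd_above.I linear)
    moreover have "\<forall>x\<in>X. \<exists>k. x \<le> real k" using real_arch_simple by blast
    ultimately show ?thesis by blast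
  next
    case True
    show ?thesis
    proof (cases "Sup X \<in> X")
      case True
      then show ?thesis
        by (intro exI[of _ "\<lambda>_. Sup X"]) (use \<open>bdd_above X\<close> in \<open>auto intro: cSup_upper incseq_const\<close>)
    next
      case False
      have "incseq (\<lambda>k. Sup X - 1 / real (Suc k))"
        by (auto simp: incseq_def frac_le)
      moreover have "\<exists>x\<in>X. Sup X - 1 / real (Suc k) \<le> x" for k
      proof -
        have "Sup X - 1 / real (Suc k) < Sup X" by simp
        then show ?thesis
          using less_cSup_iff[OF \<open>X \<noteq> {}\<close> \<open>bdd_above X\<close>] by (meson less_imp_le)
      qed
      moreover have "\<exists>k. x \<le> Sup X - 1 / real (Suc k)" if "x \<in> X" for x
      proof -
        have "x < Sup X" using cSup_upper[OF that \<open>bdd_above X\<close>] False that by (cases "x = Sup X") auto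
        then obtain k where "inverse (real (Suc k)) < Sup X - x"
          using reals_Archimedean[of "Sup X - x"] by auto
        then show ?thesis by (intro exI[of _ k]) (simp add: inverse_eq_divide)
      qed
      ultimately show ?thesis by blast
    qed
  qed
  then obtain r :: "nat \<Rightarrow> real" where r: "incseq r" "\<And>k. \<exists>x\<in>X. r k \<le> x" "\<And>x. x \<in> X \<Longrightarrow> \<exists>k. x \<le> r k"
    by blast
  have "X = (\<Union>k. X \<inter> {..r k})" using r(3) by auto
  then have "emeasure lborel X = (SUP k. emeasure lborel (X \<inter> {..r k}))"
    using r(1) by (subst SUP_emeasure_incseq) (auto simp: incseq_def intro: order_trans)
  also have "\<dots> \<le> (SUP x\<in>X. emeasure lborel (X \<inter> {..<x}))"
  proof (rule SUP_least)
    fix k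
    obtain x where x: "x \<in> X" "r k \<le> x" using r(2) by blast
    have "emeasure lborel (X \<inter> {..r k}) \<le> emeasure lborel ((X \<inter> {..<x}) \<union> {x})"
      using x by (intro emeasure_mono) auto
    also have "\<dots> \<le> emeasure lborel (X \<inter> {..<x}) + emeasure lborel {x}"
      by (intro emeasure_subadditive) auto
    finally show "emeasure lborel (X \<inter> {..r k}) \<le> (SUP x\<in>X. emeasure lborel (X \<inter> {..<x}))"
      using x(1) by (intro SUP_upper2[of x]) auto
  qed
  finally show ?thesis .
qed

lemma emeasure_above_point:
  fixes X :: "real set"
  assumes [measurable]: "X \<in> sets borel" and "X \<noteq> {}"
  shows "emeasure lborel X \<le> (SUP x\<in>X. emeasure lborel (X \<inter> {x<..}))"
proof -
  have refl: "emeasure lborel (uminus -` S) = emeasure lborel S" if [measurable]: "S \<in> sets borel" for S :: "real set"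
  proof -
    have "emeasure lborel S = emeasure (distr lborel borel uminus) S" by (simp only: lborel_distr_uminus)
    also have "\<dots> = emeasure lborel (uminus -` S)" by (subst emeasure_distr) auto
    finally show ?thesis by simp
  qed
  have m: "uminus -` X \<in> sets borel" using measurable_sets_borel[of "uminus" borel X] by simp
  have "emeasure lborel X = emeasure lborel (uminus -` X)" by (simp add: refl)
  also have "\<dots> \<le> (SUP x\<in>uminus -` X. emeasure lborel (uminus -` X \<inter> {..<x}))"
  proof (rule emeasure_below_point[OF m])
    obtain x where "x \<in> X" using \<open>X \<noteq> {}\<close> by blast
    then have "- x \<in> uminus -` X" by simp
    then show "uminus -` X \<noteq> {}" by blast
  qed
  also have "\<dots> \<le> (SUP x\<in>X. emeasure lborel (X \<inter> {x<..}))"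
  proof (rule SUP_least)
    fix x assume x: "x \<in> uminus -` X"
    have "uminus -` X \<inter> {..<x} = uminus -` (X \<inter> {-x<..})" by auto
    then show "emeasure lborel (uminus -` X \<inter> {..<x}) \<le> (SUP x\<in>X. emeasure lborel (X \<inter> {x<..}))"
      using x refl[of "X \<inter> {-x<..}"] by (intro SUP_upper2[of "-x"]) simp_all
  qed
  finally show ?thesis .
qed

text \<open>For \<open>x\<close> in \<open>X\<close> and \<open>y\<close> in \<open>Y\<close>, the
  part of \<open>X\<close> left of \<open>x\<close> translated by \<open>y\<close> and the part of
  \<open>Y\<close> right of \<open>y\<close> translated by \<open>x\<close> lie on opposite sides of
  \<open>x + y\<close>. They are therefore disjoint, and both are contained in \<open>Z\<close>. The
  supremum over the cut points recovers the full measures.\<close>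

lemma Brunn_Minkowski_real:
  fixes X Y Z :: "real set"
  assumes [measurable]: "X \<in> sets borel" "Y \<in> sets borel" "Z \<in> sets borel"
    and ne: "X \<noteq> {}" "Y \<noteq> {}"
    and sum: "\<And>x y. x \<in> X \<Longrightarrow> y \<in> Y \<Longrightarrow> x + y \<in> Z"
  shows "emeasure lborel X + emeasure lborel Y \<le> emeasure lborel Z"
proof -
  have *: "emeasure lborel (X \<inter> {..<x}) + emeasure lborel (Y \<inter> {y<..}) \<le> emeasure lborel Z"
    if "x \<in> X" "y \<in> Y" for x y
  proof -
    have "emeasure lborel (X \<inter> {..<x}) + emeasure lborel (Y \<inter> {y<..})
        = emeasure lborel {z. z - y \<in> X \<inter> {..<x}} + emeasure lborel {z. z - x \<in> Y \<inter> {y<..}}"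
      by (simp only: emeasure_lborel_shift assms sets.Int lessThan_borel greaterThan_borel)
    also have "\<dots> = emeasure lborel ({z. z - y \<in> X \<inter> {..<x}} \<union> {z. z - x \<in> Y \<inter> {y<..}})"
      by (subst plus_emeasure) auto
    also have "\<dots> \<le> emeasure lborel Z"
    proof (rule emeasure_mono)
      show "{z. z - y \<in> X \<inter> {..<x}} \<union> {z. z - x \<in> Y \<inter> {y<..}} \<subseteq> Z"
      proof
        fix z assume "z \<in> {z. z - y \<in> X \<inter> {..<x}} \<union> {z. z - x \<in> Y \<inter> {y<..}}"
        then show "z \<in> Z" using sum[of "z - y" y] sum[of x "z - x"] that by auto
      qed
    qed simp
    finally show ?thesis .
  qed
  have "emeasure lborel X + emeasure lborel Y
      \<le> (SUP x\<in>X. emeasure lborel (X \<inter> {..<x})) + (SUP y\<in>Y. emeasure lborel (Y \<inter> {y<..}))"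
    by (intro add_mono emeasure_below_point emeasure_above_point) (auto simp: ne)
  also have "\<dots> = (SUP y\<in>Y. SUP x\<in>X. emeasure lborel (X \<inter> {..<x}) + emeasure lborel (Y \<inter> {y<..}))"
    using ne by (simp add: ennreal_SUP_add_left ennreal_SUP_add_right)
  also have "\<dots> \<le> emeasure lborel Z"
    using * by (intro SUP_least) auto
  finally show ?thesis .
qed

section \<open>Prekopa-Leindler on the real line, by comparison of level sets\<close>

lemma emeasure_lborel_greaterThan: "emeasure lborel {a::real<..} = \<infinity>"
proof -
  have "ennreal (real k) \<le> emeasure lborel {a<..}" for k
  proof -
    have "ennreal (real k) = emeasure lborel {a<..<a + real k}" by simp
    also have "\<dots> \<le> emeasure lborel {a<..}" by (intro emeasure_mono) auto
    finally show ?thesis .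
  qed
  then show ?thesis
    using ennreal_Ex_less_of_nat[of "emeasure lborel {a<..}"]
    by (metis ennreal_of_nat_eq_real_of_nat infinity_ennreal_def not_le top.not_eq_extremum)
qed

lemma layer_cake:
  fixes u :: "'a::euclidean_space \<Rightarrow> ennreal"
  assumes [measurable]: "u \<in> borel_measurable borel"
  shows "(\<integral>\<^sup>+x. u x \<partial>lborel) = (\<integral>\<^sup>+t. indicator {0<..} t * emeasure lborel {x. ennreal t < u x} \<partial>lborel)"
proof -
  have u: "u x = (\<integral>\<^sup>+t. indicator {t. 0 < t \<and> ennreal t < u x} t \<partial>lborel)" for x
  proof (cases "u x")
    case (real r)
    then have "{t. 0 < t \<and> ennreal t < u x} = {0<..<r}"
      by (auto simp: ennreal_less_iff)
    then show ?thesis using real by simp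
  next
    case top
    then have "{t::real. 0 < t \<and> ennreal t < u x} = {0<..}" by auto
    then show ?thesis using top by (simp add: emeasure_lborel_greaterThan)
  qed
  have "(\<integral>\<^sup>+x. u x \<partial>lborel) = (\<integral>\<^sup>+x. \<integral>\<^sup>+t. indicator {t. 0 < t \<and> ennreal t < u x} t \<partial>lborel \<partial>lborel)"
    by (subst u) simp
  also have "\<dots> = (\<integral>\<^sup>+t. \<integral>\<^sup>+x. indicator {t. 0 < t \<and> ennreal t < u x} t \<partial>lborel \<partial>lborel)"
    by (rule lborel_pair.Fubini') measurable
  also have "\<dots> = (\<integral>\<^sup>+t. indicator {0<..} t * emeasure lborel {x. ennreal t < u x} \<partial>lborel)"
  proof (intro nn_integral_cong)
    fix t :: real
    have "(\<integral>\<^sup>+x. indicator {t. 0 < t \<and> ennreal t < u x} t \<partial>lborel)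
        = (\<integral>\<^sup>+x. indicator {0<..} t * indicator {x. ennreal t < u x} x \<partial>lborel)"
      by (intro nn_integral_cong) (auto simp: indicator_def)
    also have "\<dots> = indicator {0<..} t * emeasure lborel {x. ennreal t < u x}"
      by (subst nn_integral_cmult) auto
    finally show "(\<integral>\<^sup>+x. indicator {t. 0 < t \<and> ennreal t < u x} t \<partial>lborel) = \<dots>" .
  qed
  finally show ?thesis .
qed

text \<open>With both suprema equal to 1, the sets where \<open>u\<close> and \<open>v\<close>
  exceed \<open>t\<close> are nonempty for \<open>t < 1\<close> and empty for
  \<open>t \<ge> 1\<close>, so Brunn-Minkowski applies at every level that counts. If
  \<open>u x\<close> and \<open>v y\<close> exceed \<open>t\<close>, then \<open>w\<close> at the
  midpoint exceeds \<open>t\<close>, so the sumset lies in a level set of \<open>w (x / 2)\<close>.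
  The factor 2 is the Jacobian of this dilation.\<close>

lemma Prekopa_Leindler_real_normalized:
  fixes u v w :: "real \<Rightarrow> ennreal"
  assumes [measurable]: "u \<in> borel_measurable borel" "v \<in> borel_measurable borel" "w \<in> borel_measurable borel"
    and uv: "(SUP x. u x) = 1" "(SUP x. v x) = 1"
    and w: "\<And>x y. u x * v y \<le> (w ((x + y) / 2))\<^sup>2"
  shows "(\<integral>\<^sup>+x. u x \<partial>lborel) + (\<integral>\<^sup>+x. v x \<partial>lborel) \<le> 2 * (\<integral>\<^sup>+x. w x \<partial>lborel)"
proof -
  have level: "indicator {0<..} t * emeasure lborel {x. ennreal t < u x} + indicator {0<..} t * emeasure lborel {x. ennreal t < v x}
      \<le> indicator {0<..} t * emeasure lborel {x. ennreal t < w (x / 2)}" for t :: real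
  proof (cases "0 < t \<and> t < 1")
    case True
    then have t1: "ennreal t < 1" by (simp add: ennreal_less_one_iff)
    have "emeasure lborel {x. ennreal t < u x} + emeasure lborel {x. ennreal t < v x}
       \<le> emeasure lborel {x. ennreal t < w (x / 2)}"
    proof (rule Brunn_Minkowski_real)
      show "{x. ennreal t < u x} \<noteq> {}" using t1 unfolding uv(1)[symmetric] by (auto simp: less_SUP_iff)
      show "{x. ennreal t < v x} \<noteq> {}" using t1 unfolding uv(2)[symmetric] by (auto simp: less_SUP_iff)
      fix x y assume "x \<in> {x. ennreal t < u x}" "y \<in> {x. ennreal t < v x}"
      then have xy: "ennreal t < u x" "ennreal t < v y" by auto
      have "ennreal t * ennreal t < u x * ennreal t"
        using True xy by (intro ennreal_mult_strict_right_mono) auto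
      also have "\<dots> \<le> u x * v y" using xy by (intro mult_left_mono) auto
      also have "\<dots> \<le> (w ((x + y) / 2))\<^sup>2" by (rule w)
      finally show "x + y \<in> {x. ennreal t < w (x / 2)}"
        by (metis (mono_tags) mem_Collect_eq mult_mono' not_le power2_eq_square zero_le)
    qed auto
    then show ?thesis using True by simp
  next
    case False
    have "{x. ennreal t < u x} = {}" "{x. ennreal t < v x} = {}" if "t \<ge> 1"
    proof -
      have "u x \<le> 1" "v x \<le> 1" for x using uv by (metis SUP_upper UNIV_I)+
      moreover have "1 \<le> ennreal t" using that by simp
      ultimately show "{x. ennreal t < u x} = {}" "{x. ennreal t < v x} = {}"
        by (auto simp only: order.strict_iff_not) (meson order_trans)+
    qed
    then show ?thesis using False by (cases "t > 0") auto
  qed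
  have "(\<integral>\<^sup>+x. u x \<partial>lborel) + (\<integral>\<^sup>+x. v x \<partial>lborel)
      = (\<integral>\<^sup>+t. indicator {0<..} t * emeasure lborel {x. ennreal t < u x} + indicator {0<..} t * emeasure lborel {x. ennreal t < v x} \<partial>lborel)"
    by (subst nn_integral_add) (simp_all only: layer_cake[of u] layer_cake[of v] assms, measurable)
  also have "\<dots> \<le> (\<integral>\<^sup>+t. indicator {0<..} t * emeasure lborel {x. ennreal t < w (x / 2)} \<partial>lborel)"
    by (intro nn_integral_mono level)
  also have "\<dots> = (\<integral>\<^sup>+x. w (x / 2) \<partial>lborel)"
    by (rule layer_cake[symmetric]) measurable
  also have "\<dots> = 2 * (\<integral>\<^sup>+x. w x \<partial>lborel)"
  proof -
    have "(\<integral>\<^sup>+x. w (x / 2) \<partial>lborel) = (\<integral>\<^sup>+x. w ((2 *\<^sub>R x) / 2) \<partial>lborel) * ennreal (2 ^ DIM(real))"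
      by (subst nn_integral_lborel_scale) auto
    then show ?thesis by (simp add: mult.commute)
  qed
  finally show ?thesis .
qed

text \<open>Only the midpoint case of the inequality is proved: squared, it involves no real powers,
  so it makes sense for functions with values in the extended nonnegative reals.\<close>

lemma Prekopa_Leindler_real_bounded:
  fixes u v w :: "real \<Rightarrow> ennreal"
  assumes [measurable]: "u \<in> borel_measurable borel" "v \<in> borel_measurable borel" "w \<in> borel_measurable borel"
    and bounded: "(SUP x. u x) < \<infinity>" "(SUP x. v x) < \<infinity>"
    and w: "\<And>x y. u x * v y \<le> (w ((x + y) / 2))\<^sup>2"
  shows "(\<integral>\<^sup>+x. u x \<partial>lborel) * (\<integral>\<^sup>+x. v x \<partial>lborel) \<le> (\<integral>\<^sup>+x. w x \<partial>lborel)\<^sup>2"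
proof (cases "(SUP x. u x) = 0 \<or> (SUP x. v x) = 0 \<or> (\<integral>\<^sup>+x. w x \<partial>lborel) = \<infinity>")
  case True
  have "u = (\<lambda>_. 0)" if "(SUP x. u x) = 0"
    using that by (metis SUP_upper UNIV_I bot.extremum_uniqueI bot_ennreal ext)
  moreover have "v = (\<lambda>_. 0)" if "(SUP x. v x) = 0"
    using that by (metis SUP_upper UNIV_I bot.extremum_uniqueI bot_ennreal ext)
  ultimately show ?thesis using True by (auto simp: power2_eq_square ennreal_mult_eq_top_iff top.extremum_strict ennreal_top_mult)
next
  case False
  obtain a where a: "(SUP x. u x) = ennreal a" "a > 0"
    using bounded(1) False by (cases "SUP x. u x") (auto simp: less_le)
  obtain b where b: "(SUP x. v x) = ennreal b" "b > 0"
    using bounded(2) False by (cases "SUP x. v x") (auto simp: less_le)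
  \<comment> \<open>The factor for \<open>w\<close> that preserves the hypothesis when
    \<open>u\<close> and \<open>v\<close> are divided by their suprema \<open>a\<close> and
    \<open>b\<close>: its square must be \<open>1 / (a * b)\<close>.\<close>
  define c where "c = 1 / sqrt (a * b)"
  have c: "c > 0" "c\<^sup>2 = (1 / a) * (1 / b)"
    using a b by (auto simp: c_def power_divide)
  define U where "U = (\<integral>\<^sup>+x. u x \<partial>lborel)"
  define V where "V = (\<integral>\<^sup>+x. v x \<partial>lborel)"
  obtain W where W: "(\<integral>\<^sup>+x. w x \<partial>lborel) = ennreal W" "W \<ge> 0"
    using False by (cases "\<integral>\<^sup>+x. w x \<partial>lborel") auto
  have "(\<integral>\<^sup>+x. ennreal (1/a) * u x \<partial>lborel) + (\<integral>\<^sup>+x. ennreal (1/b) * v x \<partial>lborel)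
      \<le> 2 * (\<integral>\<^sup>+x. ennreal c * w x \<partial>lborel)"
  proof (rule Prekopa_Leindler_real_normalized)
    show "(SUP x. ennreal (1/a) * u x) = 1"
      using a by (simp add: SUP_mult_left_ennreal[symmetric] ennreal_mult[symmetric])
    show "(SUP x. ennreal (1/b) * v x) = 1"
      using b by (simp add: SUP_mult_left_ennreal[symmetric] ennreal_mult[symmetric])
    fix x y
    have "ennreal (1/a) * u x * (ennreal (1/b) * v y) = ennreal ((1/a) * (1/b)) * (u x * v y)"
      using a b by (subst ennreal_mult) (auto simp: ac_simps)
    also have "\<dots> \<le> ennreal (c\<^sup>2) * (w ((x + y) / 2))\<^sup>2"
      unfolding c(2) by (intro mult_left_mono w) auto
    also have "\<dots> = (ennreal c * w ((x + y) / 2))\<^sup>2"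
      using c by (simp add: power_mult_distrib ennreal_power)
    finally show "ennreal (1/a) * u x * (ennreal (1/b) * v y) \<le> \<dots>" .
  qed auto
  then have *: "ennreal (1/a) * U + ennreal (1/b) * V \<le> 2 * (ennreal c * W)"
    unfolding U_def V_def W(1)[symmetric] by (subst (asm) (1 2 3) nn_integral_cmult) auto
  also have "\<dots> < \<infinity>"
    by (simp add: ennreal_mult_less_top)
  finally have "U < \<infinity>" "V < \<infinity>"
    using a b by (auto simp: ennreal_mult_less_top)
  then obtain U' V' where UV: "U = ennreal U'" "V = ennreal V'" "U' \<ge> 0" "V' \<ge> 0"
    by (cases U; cases V) auto
  have "ennreal (1/a * U' + 1/b * V') = ennreal (1/a) * U + ennreal (1/b) * V"
    unfolding UV using a b UV by (subst ennreal_plus) (auto simp: ennreal_mult'[symmetric])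
  also note *
  also have "2 * (ennreal c * W) = ennreal (2 * (c * W))"
    using c W by (simp add: ennreal_mult)
  finally have "1/a * U' + 1/b * V' \<le> 2 * (c * W)"
    using c W by (subst (asm) ennreal_le_iff) auto
  then have "(1/a * U' + 1/b * V')\<^sup>2 \<le> (2 * (c * W))\<^sup>2"
    using UV a b by (intro power_mono) auto
  \<comment> \<open>The arithmetic-geometric mean inequality turns the additive bound of the
    normalized case into a bound for the product, in which \<open>a\<close> and \<open>b\<close>
    cancel.\<close>
  moreover have "4 * (1/a * U') * (1/b * V') \<le> (1/a * U' + 1/b * V')\<^sup>2"
  proof -
    have "0 \<le> (1/a * U' - 1/b * V')\<^sup>2" by simp
    then show ?thesis by (simp only: power2_sum power2_diff)
  qed
  ultimately have "4 * (1/a * U') * (1/b * V') \<le> 4 * ((1/a * (1/b)) * W\<^sup>2)"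
    by (simp add: power_mult_distrib c(2))
  then have "U' * V' \<le> W\<^sup>2"
    using a b by (simp add: field_simps)
  then show ?thesis
    using UV W unfolding U_def[symmetric] V_def[symmetric]
    by (simp add: ennreal_mult[symmetric] ennreal_power)
qed

text \<open>Truncation preserves the hypothesis and makes the suprema finite; monotone convergence
  removes it. The two truncation levels are independent, so that the product of two suprema becomes
  an iterated supremum.\<close>

lemma Prekopa_Leindler_real:
  fixes u v w :: "real \<Rightarrow> ennreal"
  assumes [measurable]: "u \<in> borel_measurable borel" "v \<in> borel_measurable borel" "w \<in> borel_measurable borel"
    and w: "\<And>x y. u x * v y \<le> (w ((x + y) / 2))\<^sup>2"
  shows "(\<integral>\<^sup>+x. u x \<partial>lborel) * (\<integral>\<^sup>+x. v x \<partial>lborel) \<le> (\<integral>\<^sup>+x. w x \<partial>lborel)\<^sup>2"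
proof -
  have trunc: "(\<integral>\<^sup>+x. h x \<partial>lborel) = (SUP k. \<integral>\<^sup>+x. min (h x) (of_nat k) \<partial>lborel)"
    if [measurable]: "h \<in> borel_measurable borel" for h :: "real \<Rightarrow> ennreal"
  proof -
    have h: "h x = (SUP k. min (h x) (of_nat k))" for x
    proof -
      have "(SUP k. min (h x) (of_nat k)) = min (h x) (SUP k. of_nat k)"
        by (simp add: inf_min[symmetric] inf_SUP)
      then show ?thesis by (simp add: ennreal_SUP_of_nat_eq_top)
    qed
    have "(\<integral>\<^sup>+x. h x \<partial>lborel) = (\<integral>\<^sup>+x. (SUP k. min (h x) (of_nat k)) \<partial>lborel)"
      by (subst h) simp
    also have "\<dots> = (SUP k. \<integral>\<^sup>+x. min (h x) (of_nat k) \<partial>lborel)"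
    proof (rule nn_integral_monotone_convergence_SUP)
      show "incseq (\<lambda>k x. min (h x) (of_nat k))"
        by (intro incseq_SucI le_funI min.mono) (auto simp: of_nat_mono)
    qed measurable
    finally show ?thesis .
  qed
  have kj: "(\<integral>\<^sup>+x. min (u x) (of_nat k) \<partial>lborel) * (\<integral>\<^sup>+x. min (v x) (of_nat j) \<partial>lborel) \<le> (\<integral>\<^sup>+x. w x \<partial>lborel)\<^sup>2"
    for k j :: nat
  proof (rule Prekopa_Leindler_real_bounded)
    show "(SUP x. min (u x) (of_nat k)) < \<infinity>"
      by (rule le_less_trans[of _ "of_nat k"]) (auto intro!: SUP_least simp: of_nat_less_top)
    show "(SUP x. min (v x) (of_nat j)) < \<infinity>"
      by (rule le_less_trans[of _ "of_nat j"]) (auto intro!: SUP_least simp: of_nat_less_top)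
    show "min (u x) (of_nat k) * min (v y) (of_nat j) \<le> (w ((x + y) / 2))\<^sup>2" for x y
      by (rule order_trans[OF _ w]) (auto intro!: mult_mono)
  qed measurable
  have "(\<integral>\<^sup>+x. u x \<partial>lborel) * (\<integral>\<^sup>+x. v x \<partial>lborel)
      = (SUP j. SUP k. (\<integral>\<^sup>+x. min (u x) (of_nat k) \<partial>lborel) * (\<integral>\<^sup>+x. min (v x) (of_nat j) \<partial>lborel))"
    by (subst (1 2) trunc) (simp_all add: SUP_mult_left_ennreal SUP_mult_right_ennreal)
  also have "\<dots> \<le> (\<integral>\<^sup>+x. w x \<partial>lborel)\<^sup>2"
    using kj by (intro SUP_least)
  finally show ?thesis .
qed

text \<open>Tensorization: by the one-dimensional case, integrating out one coordinate leaves three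
  functions of the other coordinates that satisfy the same hypothesis. Points are taken extensional
  and the midpoint is restricted to \<open>I\<close>, because these are the points of the product
  space.\<close>

lemma Prekopa_Leindler_PiM:
  fixes u v w :: "('i \<Rightarrow> real) \<Rightarrow> ennreal"
  assumes "finite I"
    and "u \<in> borel_measurable (Pi\<^sub>M I (\<lambda>_. lborel))" "v \<in> borel_measurable (Pi\<^sub>M I (\<lambda>_. lborel))"
      "w \<in> borel_measurable (Pi\<^sub>M I (\<lambda>_. lborel))"
    and "\<And>x y. x \<in> extensional I \<Longrightarrow> y \<in> extensional I \<Longrightarrow>
          u x * v y \<le> (w (\<lambda>i\<in>I. (x i + y i) / 2))\<^sup>2"
  shows "(\<integral>\<^sup>+x. u x \<partial>(Pi\<^sub>M I (\<lambda>_. lborel))) * (\<integral>\<^sup>+x. v x \<partial>(Pi\<^sub>M I (\<lambda>_. lborel)))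
      \<le> (\<integral>\<^sup>+x. w x \<partial>(Pi\<^sub>M I (\<lambda>_. lborel)))\<^sup>2"
  using assms
proof (induction I arbitrary: u v w rule: finite_induct)
  case empty
  have "u (\<lambda>_. undefined) * v (\<lambda>_. undefined) \<le> (w (\<lambda>_. undefined))\<^sup>2"
    using empty.prems(4)[of "\<lambda>_. undefined" "\<lambda>_. undefined"] by (simp add: restrict_def)
  then show ?case
    by (simp add: nn_integral_count_space_finite PiM_empty)
next
  case (insert i I)
  interpret product_sigma_finite "\<lambda>_::'i. lborel::real measure" ..
  note [measurable] = insert.prems(1-3)
  have "(\<integral>\<^sup>+x. (\<integral>\<^sup>+s. u (x(i := s)) \<partial>lborel) \<partial>(Pi\<^sub>M I (\<lambda>_. lborel))) * (\<integral>\<^sup>+x. (\<integral>\<^sup>+s. v (x(i := s)) \<partial>lborel) \<partial>(Pi\<^sub>M I (\<lambda>_. lborel)))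
      \<le> (\<integral>\<^sup>+x. (\<integral>\<^sup>+s. w (x(i := s)) \<partial>lborel) \<partial>(Pi\<^sub>M I (\<lambda>_. lborel)))\<^sup>2"
  proof (rule insert.IH)
    fix x y :: "'i \<Rightarrow> real" assume xy: "x \<in> extensional I" "y \<in> extensional I"
    then have [simp]: "x \<in> space (Pi\<^sub>M I (\<lambda>_. lborel))" "y \<in> space (Pi\<^sub>M I (\<lambda>_. lborel))"
      "(\<lambda>i\<in>I. (x i + y i) / 2) \<in> space (Pi\<^sub>M I (\<lambda>_. lborel))"
      by (auto simp: space_PiM PiE_def)
    have sec: "(\<lambda>s. h (x(i := s))) \<in> borel_measurable borel"
      if [measurable]: "h \<in> borel_measurable (Pi\<^sub>M (insert i I) (\<lambda>_. lborel))"
        and x: "x \<in> space (Pi\<^sub>M I (\<lambda>_. lborel))" for h :: "('i \<Rightarrow> real) \<Rightarrow> ennreal" and x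
    proof -
      have "(\<lambda>s. x(i := s)) \<in> lborel \<rightarrow>\<^sub>M Pi\<^sub>M (insert i I) (\<lambda>_. lborel)"
        using measurable_component_update[OF x insert.hyps(2)] by simp
      from measurable_compose[OF this that(1)] show ?thesis by simp
    qed
    show "(\<integral>\<^sup>+s. u (x(i := s)) \<partial>lborel) * (\<integral>\<^sup>+s. v (y(i := s)) \<partial>lborel)
      \<le> (\<integral>\<^sup>+s. w ((\<lambda>i\<in>I. (x i + y i) / 2)(i := s)) \<partial>lborel)\<^sup>2"
    proof (rule Prekopa_Leindler_real)
      fix s t :: real
      have "(\<lambda>i\<in>I. (x i + y i) / 2)(i := (s + t) / 2)
          = (\<lambda>j\<in>insert i I. ((x(i := s)) j + (y(i := t)) j) / 2)"
        using insert.hyps by (auto simp: restrict_def fun_eq_iff)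
      moreover have "x(i := s) \<in> extensional (insert i I)" "y(i := t) \<in> extensional (insert i I)"
        using xy by (auto simp: extensional_def)
      ultimately show "u (x(i := s)) * v (y(i := t)) \<le> (w ((\<lambda>i\<in>I. (x i + y i) / 2)(i := (s + t) / 2)))\<^sup>2"
        using insert.prems(4)[of "x(i := s)" "y(i := t)"] by (simp only:)
    qed (auto intro!: sec insert.prems(1-3))
  qed measurable
  then show ?case
    using insert.hyps by (simp add: product_nn_integral_insert)
qed

theorem Prekopa_Leindler_midpoint:
  fixes u v w :: "'a::euclidean_space \<Rightarrow> ennreal"
  assumes [measurable]: "u \<in> borel_measurable borel" "v \<in> borel_measurable borel" "w \<in> borel_measurable borel"
    and w: "\<And>x y. u x * v y \<le> (w ((1/2) *\<^sub>R (x + y)))\<^sup>2"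
  shows "(\<integral>\<^sup>+x. u x \<partial>lborel) * (\<integral>\<^sup>+x. v x \<partial>lborel) \<le> (\<integral>\<^sup>+x. w x \<partial>lborel)\<^sup>2"
proof -
  let ?P = "Pi\<^sub>M (Basis::'a set) (\<lambda>_. lborel::real measure)"
  let ?T = "\<lambda>x. \<Sum>b\<in>Basis. x b *\<^sub>R (b::'a)"
  have eq: "(\<integral>\<^sup>+x. h x \<partial>lborel) = (\<integral>\<^sup>+x. h (?T x) \<partial>?P)"
    if [measurable]: "h \<in> borel_measurable borel" for h :: "'a \<Rightarrow> ennreal"
    by (subst lborel_eq) (subst nn_integral_distr, auto)
  have "(\<integral>\<^sup>+x. u (?T x) \<partial>?P) * (\<integral>\<^sup>+x. v (?T x) \<partial>?P) \<le> (\<integral>\<^sup>+x. w (?T x) \<partial>?P)\<^sup>2"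
  proof (rule Prekopa_Leindler_PiM)
    fix x y :: "'a \<Rightarrow> real"
    have "?T (\<lambda>b\<in>Basis. (x b + y b) / 2) = (1/2) *\<^sub>R (?T x + ?T y)"
      by (simp add: sum.distrib[symmetric] scaleR_sum_right algebra_simps add_divide_distrib)
    then show "u (?T x) * v (?T y) \<le> (w (?T (\<lambda>b\<in>Basis. (x b + y b) / 2)))\<^sup>2"
      using w[of "?T x" "?T y"] by simp
  qed (auto)
  then show ?thesis by (simp add: eq)
qed

section \<open>Log-concave functions and their autocorrelation\<close>

lemma log_concave_midpoint:
  assumes "log_concave f"
  shows "f x * f y \<le> (f ((1/2) *\<^sub>R (x + y)))\<^sup>2"
proof -
  have nn: "f z \<ge> 0" for z using assms by (auto simp: log_concave_def)
  have "f x powr (1 - 1/2) * f y powr (1/2) \<le> f ((1 - 1/2) *\<^sub>R x + (1/2) *\<^sub>R y)"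
    using assms[unfolded log_concave_def, THEN conjunct2, rule_format, of "1/2" x y] by simp
  then have "sqrt (f x) * sqrt (f y) \<le> f ((1/2) *\<^sub>R (x + y))"
    using nn by (simp add: powr_half_sqrt scaleR_add_right)
  then have "(sqrt (f x) * sqrt (f y))\<^sup>2 \<le> (f ((1/2) *\<^sub>R (x + y)))\<^sup>2"
    using nn by (intro power_mono) auto
  then show ?thesis using nn by (simp add: power_mult_distrib)
qed

lemma log_concave_convex_support:
  assumes "log_concave f"
  shows "convex {x. f x > 0}"
proof (rule convexI)
  fix x y :: 'a and u v :: real
  assume xy: "x \<in> {x. f x > 0}" "y \<in> {x. f x > 0}" and uv: "0 \<le> u" "0 \<le> v" "u + v = 1"
  show "u *\<^sub>R x + v *\<^sub>R y \<in> {x. f x > 0}"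
  proof (cases "u = 0 \<or> v = 0")
    case False
    then have v: "0 < v" "v < 1" "u = 1 - v" using uv by auto
    have "0 < f x powr (1 - v) * f y powr v" using xy by simp
    also have "\<dots> \<le> f ((1 - v) *\<^sub>R x + v *\<^sub>R y)"
      using assms v by (auto simp: log_concave_def)
    finally show ?thesis using v by simp
  qed (use xy uv in auto)
qed

text \<open>Restricting a log-concave function to the interior of its support changes it only on a null set
  and makes it Borel measurable and continuous off the frontier of that interior.\<close>

definition open_part :: "('a::euclidean_space \<Rightarrow> real) \<Rightarrow> 'a \<Rightarrow> real" where
  "open_part f x = (if x \<in> interior {x. f x > 0} then f x else 0)"

lemma open_part_log_concave:
  assumes "log_concave f"
  shows "log_concave (open_part f)"
  unfolding log_concave_def
proof (intro conjI allI impI)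
  have nn: "f z \<ge> 0" for z using assms by (auto simp: log_concave_def)
  show nn': "0 \<le> open_part f x" for x using nn by (simp add: open_part_def)
  fix x y :: 'a and l :: real assume l: "0 < l \<and> l < 1"
  show "open_part f x powr (1 - l) * open_part f y powr l \<le> open_part f ((1 - l) *\<^sub>R x + l *\<^sub>R y)"
  proof (cases "x \<in> interior {x. f x > 0} \<and> y \<in> interior {x. f x > 0}")
    case True
    have "(1 - l) *\<^sub>R x + l *\<^sub>R y \<in> interior {x. f x > 0}"
      using True l convexD[OF convex_interior[OF log_concave_convex_support[OF assms]]] by auto
    then show ?thesis using True assms l by (auto simp: open_part_def log_concave_def)
  next
    case False
    then have "open_part f x powr (1 - l) * open_part f y powr l = 0"
      by (auto simp: open_part_def)
    then show ?thesis using nn' by (simp only:)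
  qed
qed

text \<open>The two functions can differ only on the frontier of the support, and the frontier of a
  convex set is negligible.\<close>

lemma open_part_AE_eq:
  assumes "log_concave f"
  shows "AE x in lebesgue. open_part f x = f x"
proof -
  have "negligible (frontier {x. f x > 0})"
    by (intro negligible_convex_frontier log_concave_convex_support assms)
  then have "frontier {x. f x > 0} \<in> null_sets lebesgue"
    by (simp add: negligible_iff_null_sets)
  moreover have "open_part f x = f x" if "x \<notin> frontier {x. f x > 0}" for x
  proof (cases "x \<in> interior {x. f x > 0}")
    case False
    then have "x \<notin> {x. f x > 0}" using that closure_subset[of "{x. f x > 0}"] unfolding frontier_def by blast
    then show ?thesis using False assms
      by (auto simp: open_part_def log_concave_def not_less intro: antisym)
  qed (simp add: open_part_def)
  ultimately show ?thesis
    by (intro AE_I'[of "frontier {x. f x > 0}"]) auto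
qed

lemma log_concave_continuous_on:
  fixes f :: "'a::euclidean_space \<Rightarrow> real"
  assumes "log_concave f"
  shows "continuous_on (interior {x. f x > 0}) f"
proof -
  let ?U = "interior {x. f x > 0}"
  have pos: "f x > 0" if "x \<in> ?U" for x using that interior_subset by blast
  have "convex_on ?U (\<lambda>x. - ln (f x))"
  proof (rule convex_onI)
    show U: "convex ?U" by (intro convex_interior log_concave_convex_support assms)
    fix t x y assume t: "0 < t" "t < (1::real)" and xy: "x \<in> ?U" "y \<in> ?U"
    have "(1 - t) *\<^sub>R x + t *\<^sub>R y \<in> ?U" using U xy t by (auto intro!: convexD)
    have "(1 - t) * ln (f x) + t * ln (f y) = ln (f x powr (1 - t) * f y powr t)"
      using pos[OF xy(1)] pos[OF xy(2)] by (simp add: ln_mult ln_powr)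
    also have "\<dots> \<le> ln (f ((1 - t) *\<^sub>R x + t *\<^sub>R y))"
      using pos[OF xy(1)] pos[OF xy(2)] assms t by (intro ln_mono) (auto simp: log_concave_def)
    finally show "- ln (f ((1 - t) *\<^sub>R x + t *\<^sub>R y)) \<le> (1 - t) * - ln (f x) + t * - ln (f y)"
      by (simp add: algebra_simps)
  qed
  then have "continuous_on ?U (\<lambda>x. - ln (f x))"
    by (intro convex_on_continuous) auto
  from continuous_on_exp[OF continuous_on_minus[OF this]]
  have "continuous_on ?U (\<lambda>x. exp (- (- ln (f x))))" .
  then show ?thesis
    by (rule continuous_on_eq) (use pos in auto)
qed

lemma open_part_isCont:
  fixes f :: "'a::euclidean_space \<Rightarrow> real"
  assumes "log_concave f" "x \<notin> frontier (interior {x. f x > 0})"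
  shows "isCont (open_part f) x"
proof (cases "x \<in> interior {x. f x > 0}")
  case True
  have "continuous_on (interior {x. f x > 0}) (open_part f)"
    by (rule continuous_on_eq[OF log_concave_continuous_on[OF assms(1)]]) (simp add: open_part_def)
  then show ?thesis using True by (simp add: continuous_on_eq_continuous_at)
next
  case False
  let ?V = "- closure (interior {x. f x > 0})"
  have V: "x \<in> ?V" using False assms(2) by (simp add: frontier_def)
  have "continuous_on ?V (open_part f)"
    by (rule continuous_on_eq[of _ "\<lambda>_. 0"])
      (use closure_subset[of "interior {x. f x > 0}"] in \<open>auto simp: open_part_def\<close>)
  moreover have "open ?V" by auto
  ultimately show ?thesis using V continuous_on_eq_continuous_at by blast
qed

lemma open_part_measurable [measurable]:
  fixes f :: "'a::euclidean_space \<Rightarrow> real"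
  assumes "log_concave f"
  shows "open_part f \<in> borel_measurable borel"
proof -
  have "(\<lambda>x. if x \<in> interior {x. f x > 0} then f x else 0) \<in> borel_measurable borel"
    by (rule borel_measurable_continuous_on_if[where g="\<lambda>_. 0"]) (auto intro: log_concave_continuous_on[OF assms])
  then show ?thesis by (simp add: open_part_def[abs_def])
qed

text \<open>The properties of \<open>open_part f\<close> when the support of \<open>f\<close> has
  nonempty interior \<open>U\<close>. Convexity of \<open>U\<close> makes the frontier null, so
  \<open>isCont\<close> amounts to continuity almost everywhere.\<close>

locale nontrivial_log_concave =
  fixes f :: "'a::euclidean_space \<Rightarrow> real" and U :: "'a set"
  assumes logc: "log_concave f"
    and meas [measurable]: "f \<in> borel_measurable borel"
    and openU: "open U" and convexU: "convex U" and neU: "U \<noteq> {}"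
    and pos: "\<And>x. x \<in> U \<Longrightarrow> f x > 0"
    and isCont: "\<And>x. x \<notin> frontier U \<Longrightarrow> isCont f x"
    and sq_integrable: "integrable lborel (\<lambda>x. (f x)\<^sup>2)"
begin

lemma nonneg: "f x \<ge> 0"
  using logc by (simp add: log_concave_def)

text \<open>Integrability and boundedness both come from \<open>f x * f y \<le> (f ((x + y) / 2))\<^sup>2\<close>:
  integrate in \<open>x\<close> for a fixed \<open>y\<close> with \<open>f y > 0\<close>, respectively in \<open>y\<close> over a ball on which
  \<open>f\<close> is bounded away from zero.\<close>

lemma half_integral: "(\<integral>\<^sup>+x. ennreal ((f ((1/2) *\<^sub>R (x + c)))\<^sup>2) \<partial>lborel) < \<infinity>"
proof -
  have "(\<integral>\<^sup>+x. ennreal ((f ((1/2) *\<^sub>R (x + c)))\<^sup>2) \<partial>lborel)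
      = (\<integral>\<^sup>+x. ennreal ((f ((1/2) *\<^sub>R x))\<^sup>2) \<partial>lborel)"
    by (subst nn_integral_lborel_shift[of "\<lambda>x. ennreal ((f ((1/2) *\<^sub>R x))\<^sup>2)"]) auto
  also have "\<dots> * ennreal ((1/2) ^ DIM('a)) = (\<integral>\<^sup>+x. ennreal ((f x)\<^sup>2) \<partial>lborel)"
    by (rule nn_integral_lborel_scale) auto
  also have "\<dots> < \<infinity>"
    using sq_integrable by (auto simp: integrable_iff_bounded)
  finally show ?thesis
    by (auto simp: ennreal_mult_less_top zero_less_power)
qed

lemma integrable: "integrable lborel f"
proof -
  obtain y where y: "y \<in> U" using neU by blast
  have "ennreal (f y) * (\<integral>\<^sup>+x. ennreal (f x) \<partial>lborel) = (\<integral>\<^sup>+x. ennreal (f x * f y) \<partial>lborel)"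
    by (subst nn_integral_cmult[symmetric]) (auto simp: ennreal_mult nonneg mult.commute)
  also have "\<dots> \<le> (\<integral>\<^sup>+x. ennreal ((f ((1/2) *\<^sub>R (x + y)))\<^sup>2) \<partial>lborel)"
    by (intro nn_integral_mono ennreal_leI log_concave_midpoint logc)
  also have "\<dots> < \<infinity>" by (rule half_integral)
  finally show ?thesis
    using pos[OF y] by (auto simp: ennreal_mult_less_top integrable_iff_bounded nonneg)
qed

lemma bounded: "\<exists>M. \<forall>x. f x \<le> M"
proof -
  obtain y where y: "y \<in> U" using neU by blast
  have "isCont f y" using y openU by (intro isCont) (simp add: frontier_def interior_open)
  then have "\<forall>\<^sub>F z in nhds y. f z > f y / 2"
    unfolding isCont_def tendsto_at_iff_tendsto_nhds using pos[OF y] by (intro order_tendstoD) auto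
  then obtain r where r: "r > 0" "\<And>z. dist z y < r \<Longrightarrow> f z > f y / 2"
    by (auto simp: eventually_nhds_metric)
  define m where "m = measure lborel (ball y r)"
  have m: "emeasure lborel (ball y r) = ennreal m"
    unfolding m_def by (intro emeasure_eq_ennreal_measure) (use emeasure_bounded_finite[of "ball y r"] in auto)
  have "m > 0" unfolding m_def using r content_ball_pos[of r y] by (simp add: measure_completion)
  define c where "c = f y / 2 * m"
  have c: "c > 0" using \<open>m > 0\<close> pos[OF y] by (simp add: c_def)
  obtain J where J: "(\<integral>\<^sup>+z. ennreal ((f ((1/2) *\<^sub>R (z + 0)))\<^sup>2) \<partial>lborel) = ennreal J" "J \<ge> 0"
    using half_integral[of 0] by (cases "\<integral>\<^sup>+z. ennreal ((f ((1/2) *\<^sub>R (z + 0)))\<^sup>2) \<partial>lborel") auto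
  have "f x \<le> J / c" for x
  proof -
    have "ennreal (f x * c) = (\<integral>\<^sup>+z. ennreal (f x * (f y / 2)) * indicator (ball y r) z \<partial>lborel)"
      using nonneg[of x] pos[OF y] \<open>m > 0\<close> by (subst nn_integral_cmult_indicator) (auto simp: m c_def ennreal_mult[symmetric] mult.assoc)
    also have "\<dots> \<le> (\<integral>\<^sup>+z. ennreal ((f ((1/2) *\<^sub>R (z + x)))\<^sup>2) \<partial>lborel)"
    proof (intro nn_integral_mono)
      fix z
      show "ennreal (f x * (f y / 2)) * indicator (ball y r) z \<le> ennreal ((f ((1/2) *\<^sub>R (z + x)))\<^sup>2)"
      proof (cases "z \<in> ball y r")
        case True
        then have "f x * (f y / 2) \<le> f x * f z"
          using r(2)[of z] nonneg[of x] by (intro mult_left_mono) (auto simp: dist_commute)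
        also have "\<dots> \<le> (f ((1/2) *\<^sub>R (z + x)))\<^sup>2"
          using log_concave_midpoint[OF logc, of z x] by (simp add: mult.commute)
        finally show ?thesis using True by (auto intro: ennreal_leI)
      qed simp
    qed
    \<comment> \<open>Translation by \<open>x\<close> does not change the integral, so the bound
      obtained is the same for all \<open>x\<close>.\<close>
    also have "\<dots> = (\<integral>\<^sup>+z. ennreal ((f ((1/2) *\<^sub>R (z + 0)))\<^sup>2) \<partial>lborel)"
      using nn_integral_lborel_shift[of "\<lambda>z. ennreal ((f ((1/2) *\<^sub>R z))\<^sup>2)" x] by simp
    finally have "f x * c \<le> J" using J by (simp add: ennreal_le_iff)
    then show ?thesis using c by (simp add: field_simps)
  qed
  then show ?thesis by blast
qed


section \<open>The autocorrelation and its log-concavity\<close>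

definition autocorr :: "'a \<Rightarrow> real" where
  "autocorr y = (\<integral>x. f x * f (x + y) \<partial>lborel)"

lemma autocorr_integrable: "integrable lborel (\<lambda>x. f x * f (x + y))"
proof -
  obtain M where M: "\<And>x. f x \<le> M" using bounded by blast
  show ?thesis
  proof (rule Bochner_Integration.integrable_bound[OF integrable_mult_right[OF integrable, of M]])
    show "AE x in lborel. norm (f x * f (x + y)) \<le> norm (M * f x)"
    proof (intro AE_I2)
      fix x
      have "f (x + y) * f x \<le> M * f x" using M nonneg by (intro mult_right_mono)
      then show "norm (f x * f (x + y)) \<le> norm (M * f x)"
        using nonneg[of x] nonneg[of "x+y"] by (simp add: mult.commute)
    qed
  qed measurable
qed

lemma autocorr_nonneg: "autocorr y \<ge> 0"
  unfolding autocorr_def by (intro integral_nonneg_AE AE_I2 mult_nonneg_nonneg nonneg)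

lemma nn_integral_autocorr: "(\<integral>\<^sup>+x. ennreal (f x * f (x + y)) \<partial>lborel) = ennreal (autocorr y)"
  unfolding autocorr_def
  by (intro nn_integral_eq_integral autocorr_integrable AE_I2 mult_nonneg_nonneg nonneg)

lemma autocorr_0: "autocorr 0 = (\<integral>x. (f x)\<^sup>2 \<partial>lborel)"
  by (simp add: autocorr_def power2_eq_square)

lemma integral_shift_diff_sq:
  "(\<integral>\<^sup>+x. ennreal ((f (x + y) - f x)\<^sup>2) \<partial>lborel) = ennreal (2 * (autocorr 0 - autocorr y))"
  "autocorr y \<le> autocorr 0"
proof -
  have s: "integrable lborel (\<lambda>x. (f (x + y))\<^sup>2)"
    using integrable_lborel_shift[OF sq_integrable, of y] by simp
  have s': "(\<integral>x. (f (x + y))\<^sup>2 \<partial>lborel) = autocorr 0"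
  proof -
    have "(\<integral>\<^sup>+x. ennreal ((f (x + y))\<^sup>2) \<partial>lborel) = (\<integral>\<^sup>+x. ennreal ((f x)\<^sup>2) \<partial>lborel)"
      using nn_integral_lborel_shift[of "\<lambda>x. ennreal ((f x)\<^sup>2)" y] by simp
    then show ?thesis unfolding autocorr_0 
      by (subst (1 2) integral_eq_nn_integral) auto
  qed
  have eq: "(f (x + y) - f x)\<^sup>2 = (f (x + y))\<^sup>2 + (f x)\<^sup>2 - 2 * (f x * f (x + y))" for x
    by (simp add: power2_diff)
  have int: "integrable lborel (\<lambda>x. (f (x + y) - f x)\<^sup>2)"
    unfolding eq by (intro Bochner_Integration.integrable_diff Bochner_Integration.integrable_add s sq_integrable integrable_mult_right autocorr_integrable)
  have val: "(\<integral>x. (f (x + y) - f x)\<^sup>2 \<partial>lborel) = 2 * (autocorr 0 - autocorr y)"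
    unfolding eq using s sq_integrable autocorr_integrable[of y]
    by (simp add: s') (simp add: autocorr_0 autocorr_def power2_eq_square)
  show "(\<integral>\<^sup>+x. ennreal ((f (x + y) - f x)\<^sup>2) \<partial>lborel) = ennreal (2 * (autocorr 0 - autocorr y))"
    by (subst nn_integral_eq_integral[OF int]) (auto simp: val)
  have "0 \<le> (\<integral>x. (f (x + y) - f x)\<^sup>2 \<partial>lborel)" by simp
  then show "autocorr y \<le> autocorr 0" unfolding val by simp
qed

lemma autocorr_0_pos: "autocorr 0 > 0"
proof (rule ccontr)
  assume "\<not> autocorr 0 > 0"
  then have "(\<integral>x. (f x)\<^sup>2 \<partial>lborel) = 0" using autocorr_nonneg[of 0] unfolding autocorr_0 by linarith
  then have "AE x in lborel. (f x)\<^sup>2 = 0"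
    by (subst (asm) integral_nonneg_eq_0_iff_AE) (auto intro: sq_integrable)
  then have "AE x in lborel. x \<notin> U" 
    by eventually_elim (use pos in force)
  then have "emeasure lborel U = 0"
    by (subst (asm) AE_iff_measurable[OF _ refl]) (use openU in auto)
  then have "negligible U"
    using openU by (auto simp: negligible_iff_null_sets null_sets_def borel_open)
  then show False using openU neU by (meson open_not_negligible)
qed

text \<open>Dominated convergence with a multiple of \<open>f\<close> as majorant. For almost every
  \<open>x\<close> the point \<open>x + y\<close> avoids the frontier of \<open>U\<close>, and there
  \<open>f\<close> is continuous.\<close>

lemma autocorr_tendsto:
  assumes "z \<longlonglongrightarrow> y"
  shows "(\<lambda>k. autocorr (z k)) \<longlonglongrightarrow> autocorr y"
  unfolding autocorr_def
proof -
  obtain M where M: "\<And>x. f x \<le> M" using bounded by blast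
  show "(\<lambda>k. \<integral>x. f x * f (x + z k) \<partial>lborel) \<longlonglongrightarrow> (\<integral>x. f x * f (x + y) \<partial>lborel)"
  proof (rule integral_dominated_convergence[where w="\<lambda>x. M * f x"])
    show "integrable lborel (\<lambda>x. M * f x)" by (intro integrable_mult_right integrable)
    show "AE x in lborel. norm (f x * f (x + z k)) \<le> M * f x" for k
    proof (intro AE_I2)
      fix x
      have "f (x + z k) * f x \<le> M * f x" using M nonneg by (intro mult_right_mono)
      then show "norm (f x * f (x + z k)) \<le> M * f x"
        using nonneg[of x] nonneg[of "x+z k"] by (simp add: mult.commute)
    qed
    have "frontier U \<in> null_sets lborel"
      using negligible_convex_frontier[OF convexU] 
      by (simp add: negligible_iff_null_sets null_sets_completion_iff)
    moreover have [measurable]: "frontier U \<in> sets borel" by (simp add: borel_closed)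
    ultimately have "emeasure lborel {x. x - (- y) \<in> frontier U} = 0"
      by (subst emeasure_lborel_shift) auto
    then have "{x. x - (- y) \<in> frontier U} \<in> null_sets lborel"
      by (intro null_setsI) simp_all
    from AE_not_in[OF this] have "AE x in lborel. x + y \<notin> frontier U" by simp
    then show "AE x in lborel. (\<lambda>k. f x * f (x + z k)) \<longlonglongrightarrow> f x * f (x + y)"
    proof eventually_elim
      case (elim x)
      have "(\<lambda>k. x + z k) \<longlonglongrightarrow> x + y" using assms by (intro tendsto_intros)
      then have "(\<lambda>k. f (x + z k)) \<longlonglongrightarrow> f (x + y)"
        using isCont[OF elim] isCont_tendsto_compose by blast
      then show ?case by (intro tendsto_intros)
    qed
  qed measurable
qed

text \<open>Prekopa-Leindler for the three integrands. Its hypothesis is the midpoint inequality of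
  \<open>f\<close> used twice, once at \<open>a\<close> and \<open>b\<close> and once at
  \<open>a + y\<close> and \<open>b + z\<close>.\<close>

lemma autocorr_midpoint: "autocorr y * autocorr z \<le> (autocorr ((1/2) *\<^sub>R (y + z)))\<^sup>2"
proof -
  let ?m = "(1/2) *\<^sub>R (y + z)"
  have "(\<integral>\<^sup>+x. ennreal (f x * f (x + y)) \<partial>lborel) * (\<integral>\<^sup>+x. ennreal (f x * f (x + z)) \<partial>lborel)
      \<le> (\<integral>\<^sup>+x. ennreal (f x * f (x + ?m)) \<partial>lborel)\<^sup>2"
  proof (rule Prekopa_Leindler_midpoint)
    fix a b
    have "f a * f (a + y) * (f b * f (b + z)) = (f a * f b) * (f (a + y) * f (b + z))" by simp
    also have "\<dots> \<le> (f ((1/2) *\<^sub>R (a + b)))\<^sup>2 * (f ((1/2) *\<^sub>R ((a + y) + (b + z))))\<^sup>2"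
      by (intro mult_mono log_concave_midpoint logc) (auto simp: nonneg)
    also have "(1/2) *\<^sub>R ((a + y) + (b + z)) = (1/2) *\<^sub>R (a + b) + ?m"
      by (simp add: algebra_simps)
    finally show "ennreal (f a * f (a + y)) * ennreal (f b * f (b + z))
        \<le> (ennreal (f ((1/2) *\<^sub>R (a + b)) * f ((1/2) *\<^sub>R (a + b) + ?m)))\<^sup>2"
      by (simp add: ennreal_mult[symmetric] nonneg ennreal_power power_mult_distrib ennreal_leI)
  qed measurable
  then show ?thesis
    unfolding nn_integral_autocorr
    by (simp add: ennreal_mult[symmetric] autocorr_nonneg ennreal_power)
qed

lemma autocorr_borel [measurable]: "autocorr \<in> borel_measurable borel"
  unfolding autocorr_def[abs_def] by measurable

lemma nn_integral_autocorr_total: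
  "(\<integral>\<^sup>+y. ennreal (autocorr y) \<partial>lborel) = (\<integral>\<^sup>+x. ennreal (f x) \<partial>lborel)\<^sup>2"
proof -
  have "(\<integral>\<^sup>+y. ennreal (autocorr y) \<partial>lborel) = (\<integral>\<^sup>+y. \<integral>\<^sup>+x. ennreal (f x * f (x + y)) \<partial>lborel \<partial>lborel)"
    by (simp add: nn_integral_autocorr)
  also have "\<dots> = (\<integral>\<^sup>+x. \<integral>\<^sup>+y. ennreal (f x * f (x + y)) \<partial>lborel \<partial>lborel)"
    by (rule lborel_pair.Fubini') measurable
  also have "\<dots> = (\<integral>\<^sup>+x. ennreal (f x) * (\<integral>\<^sup>+y. ennreal (f y) \<partial>lborel) \<partial>lborel)"
  proof (intro nn_integral_cong)
    fix x
    have "(\<integral>\<^sup>+y. ennreal (f x * f (x + y)) \<partial>lborel) = ennreal (f x) * (\<integral>\<^sup>+y. ennreal (f (y + x)) \<partial>lborel)"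
      by (subst nn_integral_cmult[symmetric]) (auto simp: ennreal_mult nonneg add.commute)
    then show "(\<integral>\<^sup>+y. ennreal (f x * f (x + y)) \<partial>lborel) = ennreal (f x) * (\<integral>\<^sup>+y. ennreal (f y) \<partial>lborel)"
      using nn_integral_lborel_shift[of "\<lambda>y. ennreal (f y)" x] by simp
  qed
  also have "\<dots> = (\<integral>\<^sup>+x. ennreal (f x) \<partial>lborel)\<^sup>2"
    by (subst nn_integral_multc) (auto simp: power2_eq_square)
  finally show ?thesis .
qed

text \<open>Repeated bisection of the segment from 0 to \<open>y\<close>: at level
  \<open>m + 1\<close> an even numerator is already treated, and an odd one is the midpoint of two
  neighbours at level \<open>m\<close>.\<close>

lemma autocorr_dyadic:
  assumes "k \<le> 2 ^ m"
  shows "(autocorr y / autocorr 0) powr (real k / 2 ^ m) \<le> autocorr ((real k / 2 ^ m) *\<^sub>R y) / autocorr 0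
    \<or> autocorr y = 0"
proof (cases "autocorr y = 0")
  case False
  define h where "h t = autocorr (t *\<^sub>R y) / autocorr 0" for t
  have h1: "h 1 > 0" using False autocorr_nonneg[of y] autocorr_0_pos by (simp add: h_def)
  have hnn: "h t \<ge> 0" for t using autocorr_nonneg autocorr_0_pos by (simp add: h_def less_imp_le)
  have mid: "h s * h t \<le> (h ((s + t) / 2))\<^sup>2" for s t
  proof -
    have "autocorr (s *\<^sub>R y) * autocorr (t *\<^sub>R y) \<le> (autocorr (((s + t) / 2) *\<^sub>R y))\<^sup>2"
      using autocorr_midpoint[of "s *\<^sub>R y" "t *\<^sub>R y"] by (simp add: scaleR_add_left[symmetric])
    then show ?thesis using autocorr_0_pos
      by (simp add: h_def power_divide power2_eq_square divide_right_mono)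
  qed
  have "h 1 powr (real k / 2 ^ m) \<le> h (real k / 2 ^ m)"
    using assms
  proof (induction m arbitrary: k)
    case 0
    then have "k = 0 \<or> k = 1" by auto
    then show ?case using h1 autocorr_0_pos by (auto simp: h_def)
  next
    case (Suc m)
    show ?case
    proof (cases "even k")
      case True
      then obtain j where "k = 2 * j" by blast
      then show ?thesis using Suc.IH[of j] Suc.prems by simp
    next
      case False
      then obtain j where j: "k = 2 * j + 1" by (auto elim: oddE)
      have "j + 1 \<le> 2 ^ m" using Suc.prems j by simp
      let ?a = "real j / 2 ^ m" and ?b = "real (j + 1) / 2 ^ m"
      have "real k / 2 ^ Suc m = (?a + ?b) / 2" by (simp add: j field_simps)
      have "(h 1 powr ((?a + ?b) / 2))\<^sup>2 = h 1 powr ?a * h 1 powr ?b"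
        using h1 by (simp add: powr_add[symmetric] power2_eq_square)
      also have "\<dots> \<le> h ?a * h ?b"
        using Suc.IH[of j] Suc.IH[of "j + 1"] \<open>j + 1 \<le> 2 ^ m\<close> by (intro mult_mono hnn) auto
      also have "\<dots> \<le> (h ((?a + ?b) / 2))\<^sup>2" by (rule mid)
      finally have "h 1 powr ((?a + ?b) / 2) \<le> h ((?a + ?b) / 2)"
        by (rule power2_le_imp_le) (rule hnn)
      then show ?thesis using \<open>real k / 2 ^ Suc m = (?a + ?b) / 2\<close> by (simp only:)
    qed
  qed
  then show ?thesis by (simp add: h_def)
qed simp

text \<open>The dyadic numbers obtained by rounding \<open>l * 2 ^ m\<close> down converge to
  \<open>l\<close>, and continuity of \<open>autocorr\<close> passes to the limit. One endpoint is
  always the origin, where the normalized value is 1; hence the left side has a single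
  factor.\<close>

lemma autocorr_log_concave_ray:
  assumes "0 < l" "l < 1"
  shows "(autocorr y / autocorr 0) powr l \<le> autocorr (l *\<^sub>R y) / autocorr 0"
proof (cases "autocorr y = 0")
  case True
  then show ?thesis using autocorr_nonneg[of "l *\<^sub>R y"] autocorr_0_pos by simp
next
  case False
  define d where "d m = real (nat \<lfloor>l * 2 ^ m\<rfloor>) / 2 ^ m" for m :: nat
  have d: "d \<longlonglongrightarrow> l"
  proof (rule tendsto_sandwich[of "\<lambda>m. l - (1/2) ^ m" _ _ "\<lambda>_. l"])
    show "\<forall>\<^sub>F m in sequentially. l - (1/2) ^ m \<le> d m"
    proof (intro always_eventually allI)
      fix m
      have "l * 2 ^ m - 1 \<le> real (nat \<lfloor>l * 2 ^ m\<rfloor>)" using assms by linarith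
      then have "(l * 2 ^ m - 1) / 2 ^ m \<le> d m" unfolding d_def by (intro divide_right_mono) auto
      then show "l - (1/2) ^ m \<le> d m" by (simp add: diff_divide_distrib power_divide)
    qed
    show "\<forall>\<^sub>F m in sequentially. d m \<le> l"
      using assms by (intro always_eventually allI) (simp add: d_def field_simps)
    have "(\<lambda>m. l - (1/2) ^ m) \<longlonglongrightarrow> l - 0" by (intro tendsto_intros LIMSEQ_power_zero) simp
    then show "(\<lambda>m. l - (1/2) ^ m) \<longlonglongrightarrow> l" by simp
  qed simp
  have le: "(autocorr y / autocorr 0) powr d m \<le> autocorr (d m *\<^sub>R y) / autocorr 0" for m
  proof -
    have "l * 2 ^ m \<le> 2 ^ m" using assms by simp
    then have "\<lfloor>l * 2 ^ m\<rfloor> \<le> 2 ^ m"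
      by (metis floor_mono floor_of_int of_int_numeral of_int_power)
    then have "nat \<lfloor>l * 2 ^ m\<rfloor> \<le> 2 ^ m" by (simp add: nat_le_iff)
    then show ?thesis using autocorr_dyadic[of "nat \<lfloor>l * 2 ^ m\<rfloor>" m y] False by (simp add: d_def)
  qed
  have "autocorr y / autocorr 0 > 0" using False autocorr_nonneg[of y] autocorr_0_pos by simp
  show ?thesis
  proof (rule LIMSEQ_le)
    show "(\<lambda>m. (autocorr y / autocorr 0) powr d m) \<longlonglongrightarrow> (autocorr y / autocorr 0) powr l"
      using \<open>autocorr y / autocorr 0 > 0\<close> by (intro tendsto_powr tendsto_const d) auto
    show "(\<lambda>m. autocorr (d m *\<^sub>R y) / autocorr 0) \<longlonglongrightarrow> autocorr (l *\<^sub>R y) / autocorr 0"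
      using autocorr_0_pos by (intro tendsto_divide tendsto_const autocorr_tendsto tendsto_scaleR d) auto
  qed (use le in auto)
qed

end

section \<open>Integration along rays\<close>

definition ray_integral :: "('a::euclidean_space \<Rightarrow> ennreal) \<Rightarrow> 'a \<Rightarrow> ennreal" where
  "ray_integral G x = (\<integral>\<^sup>+s. indicator {0<..} s * ennreal (s ^ (DIM('a) - 1)) * G (s *\<^sub>R x) \<partial>lborel)"

lemma ray_integral_scale:
  fixes G :: "'a::euclidean_space \<Rightarrow> ennreal"
  assumes [measurable]: "G \<in> borel_measurable borel" and r: "r > 0"
  shows "ray_integral G (r *\<^sub>R x) * ennreal (r ^ DIM('a)) = ray_integral G x"
proof -
  let ?F = "\<lambda>s::real. indicator {0<..} s * ennreal (s ^ (DIM('a) - 1)) * G (s *\<^sub>R x)"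
  have "ray_integral G x = (\<integral>\<^sup>+s. ?F (r *\<^sub>R s) \<partial>lborel) * ennreal (r ^ DIM(real))"
    unfolding ray_integral_def by (rule nn_integral_lborel_scale[symmetric]) (use r in auto)
  also have "(\<integral>\<^sup>+s. ?F (r *\<^sub>R s) \<partial>lborel)
      = (\<integral>\<^sup>+s. ennreal (r ^ (DIM('a) - 1)) * (indicator {0<..} s * ennreal (s ^ (DIM('a) - 1)) * G (s *\<^sub>R (r *\<^sub>R x))) \<partial>lborel)"
    using r by (intro nn_integral_cong)
      (auto simp: indicator_def zero_less_mult_iff power_mult_distrib ennreal_mult ac_simps)
  also have "\<dots> = ennreal (r ^ (DIM('a) - 1)) * ray_integral G (r *\<^sub>R x)"
    unfolding ray_integral_def by (rule nn_integral_cmult) measurable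
  also have "\<dots> * ennreal (r ^ DIM(real)) = ray_integral G (r *\<^sub>R x) * (ennreal (r ^ (DIM('a) - 1)) * ennreal r)"
    by (simp add: ac_simps)
  also have "ennreal (r ^ (DIM('a) - 1)) * ennreal r = ennreal (r ^ DIM('a))"
    using r power_minus_mult[of "DIM('a)" r] by (simp add: ennreal_mult[symmetric])
  finally show ?thesis by simp
qed

text \<open>This fixes the outer radius \<open>exp 1\<close>: the admissible \<open>s\<close> fill
  the interval from \<open>r / exp 1\<close> to \<open>r\<close>, on which \<open>1 / s\<close> has
  integral 1 whatever \<open>r\<close> is.\<close>

lemma log_annulus_integral:
  fixes r :: real
  assumes r: "r > 0"
  shows "(\<integral>\<^sup>+s. indicator {0<..} s * ennreal (1 / s) * indicator {1..exp 1} (r / s) \<partial>lborel) = 1"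
proof -
  have "(\<integral>\<^sup>+s. indicator {0<..} s * ennreal (1 / s) * indicator {1..exp 1} (r / s) \<partial>lborel)
      = (\<integral>\<^sup>+s. ennreal (1 / s) * indicator {r / exp 1..r} s \<partial>lborel)"
  proof (intro nn_integral_cong)
    fix s :: real
    have "s > 0" if "r / exp 1 \<le> s" using that r by (meson divide_pos_pos exp_gt_zero less_le_trans)
    then show "indicator {0<..} s * ennreal (1 / s) * indicator {1..exp 1} (r / s)
        = ennreal (1 / s) * indicator {r / exp 1..r} s"
      using r by (cases "s > 0") (auto simp: indicator_def field_simps)
  qed
  also have "\<dots> = ennreal (ln r - ln (r / exp 1))"
  proof (rule nn_integral_FTC_Icc)
    fix s assume s: "s \<in> {r / exp 1..r}"
    have "r / exp 1 > 0" using r by simp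
    then have "s > 0" using s by (simp add: less_le_trans)
    then show "0 \<le> 1 / s" "DERIV ln s :> 1 / s"
      by (auto intro!: derivative_eq_intros)
  next
    show "r / exp 1 \<le> r" using r by (simp add: field_simps)
  qed measurable
  also have "\<dots> = 1" using r by (simp add: ln_div)
  finally show ?thesis .
qed

text \<open>Polar coordinates without surface measure: the annulus \<open>1 \<le> norm x \<le> exp 1\<close> meets every ray in a
  set of measure one for \<open>ds / s\<close>, so averaging over it replaces integration over the sphere.\<close>

lemma polar_annulus:
  fixes G :: "'a::euclidean_space \<Rightarrow> ennreal"
  assumes [measurable]: "G \<in> borel_measurable borel"
  shows "(\<integral>\<^sup>+y. G y \<partial>lborel) = (\<integral>\<^sup>+x. indicator {1..exp 1} (norm x) * ray_integral G x \<partial>lborel)"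
proof -
  let ?n = "DIM('a)"
  have "(\<integral>\<^sup>+x. indicator {1..exp 1} (norm x) * ray_integral G x \<partial>lborel)
      = (\<integral>\<^sup>+x. \<integral>\<^sup>+s. indicator {1..exp 1} (norm x) * (indicator {0<..} s * ennreal (s ^ (?n - 1)) * G (s *\<^sub>R x)) \<partial>lborel \<partial>lborel)"
    unfolding ray_integral_def by (subst nn_integral_cmult) auto
  also have "\<dots> = (\<integral>\<^sup>+s. \<integral>\<^sup>+x. indicator {1..exp 1} (norm x) * (indicator {0<..} s * ennreal (s ^ (?n - 1)) * G (s *\<^sub>R x)) \<partial>lborel \<partial>lborel)"
    by (rule lborel_pair.Fubini') measurable
  \<comment> \<open>For fixed \<open>s\<close> the substitution \<open>y = s *\<^sub>R x\<close> has
    Jacobian \<open>s ^ DIM('a)\<close>, which reduces the weight \<open>s ^ (DIM('a) - 1)\<close>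
    to \<open>1 / s\<close>. After another exchange of integrals the inner one no longer involves
    \<open>G\<close>.\<close>
  also have "\<dots> = (\<integral>\<^sup>+s. \<integral>\<^sup>+y. G y * (indicator {0<..} s * ennreal (1 / s) * indicator {1..exp 1} (norm y / s)) \<partial>lborel \<partial>lborel)"
  proof (rule nn_integral_cong)
    fix s :: real
    show "(\<integral>\<^sup>+x. indicator {1..exp 1} (norm x) * (indicator {0<..} s * ennreal (s ^ (?n - 1)) * G (s *\<^sub>R x)) \<partial>lborel)
        = (\<integral>\<^sup>+y. G y * (indicator {0<..} s * ennreal (1 / s) * indicator {1..exp 1} (norm y / s)) \<partial>lborel)"
    proof (cases "s > 0")
      case True
      have p: "ennreal (1 / s) * ennreal (s ^ ?n) = ennreal (s ^ (?n - 1))"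
        using True power_minus_mult[of ?n s, symmetric] by (simp add: ennreal_mult[symmetric])
      have "(\<integral>\<^sup>+y. G y * (indicator {0<..} s * ennreal (1 / s) * indicator {1..exp 1} (norm y / s)) \<partial>lborel)
          = (\<integral>\<^sup>+x. G (s *\<^sub>R x) * (indicator {0<..} s * ennreal (1 / s) * indicator {1..exp 1} (norm (s *\<^sub>R x) / s)) \<partial>lborel) * ennreal (s ^ ?n)"
        by (rule nn_integral_lborel_scale[symmetric]) (use True in measurable)
      also have "\<dots> = (\<integral>\<^sup>+x. G (s *\<^sub>R x) * (indicator {0<..} s * ennreal (1 / s) * indicator {1..exp 1} (norm (s *\<^sub>R x) / s)) * ennreal (s ^ ?n) \<partial>lborel)"
        by (rule nn_integral_multc[symmetric]) measurable
      also have "\<dots> = (\<integral>\<^sup>+x. indicator {1..exp 1} (norm x) * (indicator {0<..} s * ennreal (s ^ (?n - 1)) * G (s *\<^sub>R x)) \<partial>lborel)"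
        unfolding p[symmetric] using True by (intro nn_integral_cong) (simp add: ac_simps)
      finally show ?thesis by simp
    qed simp
  qed
  also have "\<dots> = (\<integral>\<^sup>+y. \<integral>\<^sup>+s. G y * (indicator {0<..} s * ennreal (1 / s) * indicator {1..exp 1} (norm y / s)) \<partial>lborel \<partial>lborel)"
    by (rule lborel_pair.Fubini') measurable
  also have "\<dots> = (\<integral>\<^sup>+y. G y * (\<integral>\<^sup>+s. indicator {0<..} s * ennreal (1 / s) * indicator {1..exp 1} (norm y / s) \<partial>lborel) \<partial>lborel)"
    by (subst nn_integral_cmult) auto
  also have "\<dots> = (\<integral>\<^sup>+y. G y \<partial>lborel)"
  proof (intro nn_integral_cong_AE)
    have "AE y in lborel. (y::'a) \<noteq> 0" by (rule AE_lborel_singleton)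
    then show "AE y in lborel. G y * (\<integral>\<^sup>+s. indicator {0<..} s * ennreal (1 / s) * indicator {1..exp 1} (norm y / s) \<partial>lborel) = G y"
      by eventually_elim (subst log_annulus_integral, auto)
  qed
  finally show ?thesis by simp
qed

lemma ray_integral_measurable [measurable]:
  assumes [measurable]: "G \<in> borel_measurable borel"
  shows "ray_integral G \<in> borel_measurable borel"
  unfolding ray_integral_def[abs_def] by measurable

lemma ray_integral_unit:
  fixes G :: "'a::euclidean_space \<Rightarrow> ennreal"
  assumes [measurable]: "G \<in> borel_measurable borel" and x: "x \<noteq> 0"
  shows "ray_integral G x = ray_integral G (sgn x) * ennreal (1 / norm x ^ DIM('a))"
proof -
  have "ray_integral G ((1 / norm x) *\<^sub>R x) * ennreal ((1 / norm x) ^ DIM('a)) = ray_integral G x"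
    using x by (intro ray_integral_scale) auto
  then show ?thesis by (simp add: sgn_div_norm power_divide inverse_eq_divide)
qed

text \<open>Ray integrals of \<open>G\<close> and \<open>H\<close> scale by the same factor along a
  ray, so a comparison at unit vectors extends to the whole annulus and integrates.\<close>

lemma nn_integral_le_by_rays:
  fixes G H :: "'a::euclidean_space \<Rightarrow> ennreal"
  assumes [measurable]: "G \<in> borel_measurable borel" "H \<in> borel_measurable borel"
    and ray: "\<And>\<xi>. norm \<xi> = 1 \<Longrightarrow> ray_integral G \<xi> \<le> K * ray_integral H \<xi>"
  shows "(\<integral>\<^sup>+x. G x \<partial>lborel) \<le> K * (\<integral>\<^sup>+x. H x \<partial>lborel)"
proof -
  have "(\<integral>\<^sup>+x. G x \<partial>lborel) \<le> (\<integral>\<^sup>+x. K * (indicator {1..exp 1} (norm x) * ray_integral H x) \<partial>lborel)"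
    unfolding polar_annulus[OF assms(1)]
  proof (intro nn_integral_mono)
    fix x :: 'a
    show "indicator {1..exp 1} (norm x) * ray_integral G x \<le> K * (indicator {1..exp 1} (norm x) * ray_integral H x)"
    proof (cases "x = 0")
      case False
      have "ray_integral G x \<le> K * ray_integral H x"
        using ray[of "sgn x"] False
        by (simp add: ray_integral_unit[of G x] ray_integral_unit[of H x] norm_sgn mult_right_mono mult.assoc[symmetric])
      then show ?thesis by (auto simp: indicator_def)
    qed simp
  qed
  also have "\<dots> = K * (\<integral>\<^sup>+x. H x \<partial>lborel)"
    unfolding polar_annulus[OF assms(2)] by (rule nn_integral_cmult) measurable
  finally show ?thesis .
qed

lemma nn_integral_eq_by_rays:
  fixes G H :: "'a::euclidean_space \<Rightarrow> ennreal"
  assumes [measurable]: "G \<in> borel_measurable borel" "H \<in> borel_measurable borel"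
    and ray: "\<And>\<xi>. norm \<xi> = 1 \<Longrightarrow> ray_integral G \<xi> = K * ray_integral H \<xi>"
  shows "(\<integral>\<^sup>+x. G x \<partial>lborel) = K * (\<integral>\<^sup>+x. H x \<partial>lborel)"
proof -
  have "(\<integral>\<^sup>+x. G x \<partial>lborel) = (\<integral>\<^sup>+x. K * (indicator {1..exp 1} (norm x) * ray_integral H x) \<partial>lborel)"
    unfolding polar_annulus[OF assms(1)]
  proof (intro nn_integral_cong)
    fix x :: 'a
    show "indicator {1..exp 1} (norm x) * ray_integral G x = K * (indicator {1..exp 1} (norm x) * ray_integral H x)"
    proof (cases "x = 0")
      case False
      have "ray_integral G x = K * ray_integral H x"
        using ray[of "sgn x"] False
        by (simp add: ray_integral_unit[of G x] ray_integral_unit[of H x] norm_sgn mult.assoc[symmetric])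
      then show ?thesis by (auto simp: indicator_def)
    qed simp
  qed
  also have "\<dots> = K * (\<integral>\<^sup>+x. H x \<partial>lborel)"
    unfolding polar_annulus[OF assms(2)] by (rule nn_integral_cmult) measurable
  finally show ?thesis .
qed

section \<open>Log-concave profiles on a half-line\<close>

lemma monomial_integral_infinite:
  "(\<integral>\<^sup>+s. indicator {0<..} s * ennreal (s ^ k) \<partial>lborel) = \<infinity>"
proof -
  have "\<infinity> = (\<integral>\<^sup>+s. indicator {1::real<..} s \<partial>lborel)"
    by (simp add: emeasure_lborel_greaterThan)
  also have "\<dots> \<le> (\<integral>\<^sup>+s. indicator {0<..} s * ennreal (s ^ k) \<partial>lborel)"
    by (intro nn_integral_mono) (auto simp: indicator_def)
  finally show ?thesis by (simp add: top_unique)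
qed

lemma Gamma_nn_integral_scaled:
  fixes p c :: real
  assumes p: "p > 0" and c: "c > 0"
  shows "(\<integral>\<^sup>+t. indicator {0<..} t * ennreal (t powr (p - 1) * exp (- c * t)) \<partial>lborel) = ennreal (Gamma p * c powr (- p))"
proof -
  let ?F = "\<lambda>t::real. indicator {0<..} t * ennreal (t powr (p - 1) * exp (- t))"
  have "(\<integral>\<^sup>+t. ?F t \<partial>lborel) = (\<integral>\<^sup>+t. ennreal (indicator {0..} t * t powr (p - 1) / exp t) \<partial>lborel)"
    by (intro nn_integral_cong) (auto simp: indicator_def exp_minus divide_inverse)
  also have "\<dots> = ennreal (Gamma p)" using Gamma_conv_nn_integral_real[OF p] by simp
  finally have G: "(\<integral>\<^sup>+t. ?F t \<partial>lborel) = ennreal (Gamma p)" .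
  have "(\<integral>\<^sup>+t. indicator {0<..} t * ennreal (t powr (p - 1) * exp (- c * t)) \<partial>lborel)
      = (\<integral>\<^sup>+t. ?F (c *\<^sub>R t) * ennreal (c powr (1 - p)) \<partial>lborel)"
  proof (intro nn_integral_cong)
    fix t :: real
    show "indicator {0<..} t * ennreal (t powr (p - 1) * exp (- c * t)) = ?F (c *\<^sub>R t) * ennreal (c powr (1 - p))"
    proof (cases "t > 0")
      case True
      have "t powr (p - 1) * exp (- c * t) = (c * t) powr (p - 1) * exp (- (c * t)) * c powr (1 - p)"
        using True c by (simp add: powr_mult powr_add[symmetric])
      then show ?thesis using True c by (simp add: ennreal_mult ac_simps)
    qed (use c in \<open>auto simp: indicator_def zero_less_mult_iff\<close>)
  qed
  also have "\<dots> = (\<integral>\<^sup>+t. ?F (c *\<^sub>R t) \<partial>lborel) * ennreal (c powr (1 - p))"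
    by (rule nn_integral_multc) measurable
  also have "ennreal (c powr (1 - p)) = ennreal (c ^ DIM(real)) * ennreal (c powr (- p))"
    using c by (simp add: ennreal_mult[symmetric] powr_diff powr_minus field_simps)
  also have "(\<integral>\<^sup>+t. ?F (c *\<^sub>R t) \<partial>lborel) * \<dots> = (\<integral>\<^sup>+t. ?F t \<partial>lborel) * ennreal (c powr (- p))"
    by (subst nn_integral_lborel_scale[of ?F c, symmetric]) (use c in \<open>auto simp: mult.assoc\<close>)
  also have "\<dots> = ennreal (Gamma p * c powr (- p))"
    unfolding G using Gamma_real_pos[OF p] by (simp add: ennreal_mult)
  finally show ?thesis .
qed

lemma powr_tail_integral:
  fixes b s :: real
  assumes b: "b > 0" and s: "s > 0"
  shows "(\<integral>\<^sup>+t. indicator {s..} t * ennreal (t powr (- b - 1)) \<partial>lborel) = ennreal (s powr (- b) / b)"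
proof -
  have "(\<integral>\<^sup>+t. ennreal (t powr (- b - 1)) * indicator {s..} t \<partial>lborel) = ennreal (0 - (- (s powr (- b) / b)))"
  proof (rule nn_integral_FTC_atLeast)
    fix t assume "s \<le> t"
    then have "t > 0" using s by simp
    then show "DERIV (\<lambda>t. - (t powr (- b) / b)) t :> t powr (- b - 1)"
      using b by (auto intro!: derivative_eq_intros)
    show "0 \<le> t powr (- b - 1)" by simp
  next
    have "((\<lambda>t. t powr (- b)) \<longlongrightarrow> 0) at_top"
      using b by (intro tendsto_neg_powr filterlim_ident) auto
    then have "((\<lambda>t. - (t powr (- b) / b)) \<longlongrightarrow> - (0 / b)) at_top"
      by (intro tendsto_intros) (use b in auto)
    then show "((\<lambda>t. - (t powr (- b) / b)) \<longlongrightarrow> 0) at_top" by simp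
  qed measurable
  then show ?thesis by (simp add: mult.commute)
qed

text \<open>Write \<open>1 - exp (- c * t)\<close> as the integral of
  \<open>c * exp (- c * s)\<close> over \<open>s\<close> from 0 to \<open>t\<close> and exchange the
  integrals. Integration in \<open>t\<close> leaves \<open>s powr (- b) / b\<close>, and the rest is
  a Gamma integral with parameter \<open>1 - b\<close>; this is where \<open>b < 1\<close>
  enters.\<close>

lemma one_minus_exp_integral:
  fixes b c :: real
  assumes b: "0 < b" "b < 1" and c: "c > 0"
  shows "(\<integral>\<^sup>+t. indicator {0<..} t * ennreal (t powr (- b - 1) * (1 - exp (- c * t))) \<partial>lborel)
    = ennreal (c powr b * Gamma (1 - b) / b)"
proof -
  have inner: "ennreal (1 - exp (- c * t)) = (\<integral>\<^sup>+s. ennreal (c * exp (- c * s)) * indicator {0..t} s \<partial>lborel)" if "t > 0" for t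
  proof -
    have "(\<integral>\<^sup>+s. ennreal (c * exp (- c * s)) * indicator {0..t} s \<partial>lborel) = ennreal (- exp (- c * t) - (- exp (- c * 0)))"
    proof (rule nn_integral_FTC_Icc)
      fix s show "DERIV (\<lambda>s. - exp (- c * s)) s :> c * exp (- c * s)"
        by (auto intro!: derivative_eq_intros)
      show "0 \<le> c * exp (- c * s)" using c by simp
    qed (use that in auto)
    then show ?thesis by simp
  qed
  have "(\<integral>\<^sup>+t. indicator {0<..} t * ennreal (t powr (- b - 1) * (1 - exp (- c * t))) \<partial>lborel)
      = (\<integral>\<^sup>+t. \<integral>\<^sup>+s. indicator {0<..} t * ennreal (t powr (- b - 1)) * (ennreal (c * exp (- c * s)) * indicator {0..t} s) \<partial>lborel \<partial>lborel)"
  proof (rule nn_integral_cong)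
    fix t :: real
    have "(\<integral>\<^sup>+s. indicator {0<..} t * ennreal (t powr (- b - 1)) * (ennreal (c * exp (- c * s)) * indicator {0..t} s) \<partial>lborel)
        = indicator {0<..} t * ennreal (t powr (- b - 1)) * (\<integral>\<^sup>+s. ennreal (c * exp (- c * s)) * indicator {0..t} s \<partial>lborel)"
      by (rule nn_integral_cmult) measurable
    also have "\<dots> = indicator {0<..} t * ennreal (t powr (- b - 1) * (1 - exp (- c * t)))"
      using inner[of t] c by (cases "t > 0") (auto simp: ennreal_mult)
    finally show "indicator {0<..} t * ennreal (t powr (- b - 1) * (1 - exp (- c * t)))
      = (\<integral>\<^sup>+s. indicator {0<..} t * ennreal (t powr (- b - 1)) * (ennreal (c * exp (- c * s)) * indicator {0..t} s) \<partial>lborel)" by simp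
  qed
  also have "\<dots> = (\<integral>\<^sup>+s. \<integral>\<^sup>+t. indicator {0<..} t * ennreal (t powr (- b - 1)) * (ennreal (c * exp (- c * s)) * indicator {t. 0 \<le> s \<and> s \<le> t} t) \<partial>lborel \<partial>lborel)"
    by (subst lborel_pair.Fubini') (auto simp: indicator_def)
  also have "\<dots> = (\<integral>\<^sup>+s. ennreal (c / b) * (indicator {0<..} s * ennreal (s powr ((1 - b) - 1) * exp (- c * s))) \<partial>lborel)"
  proof (rule nn_integral_cong_AE)
    have "AE s in lborel. (s::real) \<noteq> 0" by (rule AE_lborel_singleton)
    then show "AE s in lborel. (\<integral>\<^sup>+t. indicator {0<..} t * ennreal (t powr (- b - 1)) * (ennreal (c * exp (- c * s)) * indicator {t. 0 \<le> s \<and> s \<le> t} t) \<partial>lborel)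
        = ennreal (c / b) * (indicator {0<..} s * ennreal (s powr ((1 - b) - 1) * exp (- c * s)))"
    proof eventually_elim
      case (elim s)
      show ?case
      proof (cases "s > 0")
        case True
        have "(\<integral>\<^sup>+t. indicator {0<..} t * ennreal (t powr (- b - 1)) * (ennreal (c * exp (- c * s)) * indicator {t. 0 \<le> s \<and> s \<le> t} t) \<partial>lborel)
            = (\<integral>\<^sup>+t. ennreal (c * exp (- c * s)) * (indicator {s..} t * ennreal (t powr (- b - 1))) \<partial>lborel)"
          using True by (intro nn_integral_cong) (auto simp: indicator_def mult.commute)
        also have "\<dots> = ennreal (c * exp (- c * s)) * ennreal (s powr (- b) / b)"
          by (subst nn_integral_cmult) (auto simp: powr_tail_integral[OF b(1) True])
        also have "\<dots> = ennreal (c / b * (s powr (- b) * exp (- c * s)))"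
          using b c by (subst ennreal_mult[symmetric]) (auto simp: field_simps)
        finally show ?thesis using True b c by (subst (asm) ennreal_mult) auto
      next
        case False
        then show ?thesis using elim by (auto simp: indicator_def)
      qed
    qed
  qed
  also have "\<dots> = ennreal (c / b) * ennreal (Gamma (1 - b) * c powr (- (1 - b)))"
    using Gamma_nn_integral_scaled[of "1 - b" c] b c by (subst nn_integral_cmult) simp_all
  also have "\<dots> = ennreal (c powr b * Gamma (1 - b) / b)"
  proof -
    have "c * c powr (- (1 - b)) = c powr b"
      using c powr_add[of c 1 "- (1 - b)"] by simp
    moreover have "c / b * (Gamma (1 - b) * c powr (- (1 - b))) = (c * c powr (- (1 - b))) * Gamma (1 - b) / b"
      by simp
    ultimately show ?thesis using b c Gamma_real_pos[of "1 - b"] by (subst ennreal_mult[symmetric]) auto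
  qed
  finally show ?thesis .
qed

text \<open>Models the normalized autocorrelation on a ray, with \<open>b\<close> in the role of
  2\<alpha>. The assumption \<open>h_ray\<close> is concavity of the logarithm between 0 and
  \<open>t\<close>, with the value at 0 taken to be 1.\<close>

locale ray_profile =
  fixes h :: "real \<Rightarrow> real" and b :: real
  assumes b: "0 < b" "b < 1"
    and h_meas [measurable]: "h \<in> borel_measurable borel"
    and h01: "\<And>t. 0 \<le> h t" "\<And>t. h t \<le> 1"
    and h_ray: "\<And>s t. 0 < s \<Longrightarrow> s < t \<Longrightarrow> h t powr (s / t) \<le> h s"
begin

text \<open>Up to the factor \<open>2 * autocorr 0\<close>, the integral that determines the radial
  function in the direction of the ray.\<close>

definition deficit :: ennreal where
  "deficit = (\<integral>\<^sup>+t. indicator {0<..} t * ennreal (t powr (- b - 1) * (1 - h t)) \<partial>lborel)"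

text \<open>A single positive value \<open>h t1\<close> keeps \<open>h\<close> above an exponential
  on the interval from 0 to \<open>t1\<close>, which controls the singularity of the weight at 0;
  beyond \<open>t1\<close> the trivial bound 1 suffices. Both ranges are covered by a multiple of
  one explicit integrand.\<close>

lemma deficit_finite:
  assumes t1: "t1 > 0" "h t1 > 0"
  shows "deficit < \<infinity>"
proof -
  \<comment> \<open>The summand 1 keeps the rate positive even if \<open>h t1 = 1\<close>.\<close>
  define k where "k = - ln (h t1) / t1 + 1"
  have "ln (h t1) \<le> 0" using t1 h01(2)[of t1] by simp
  then have k: "k \<ge> 1" using t1 by (simp add: k_def divide_nonpos_pos)
  \<comment> \<open>Chosen such that \<open>C * (1 - exp (- k * t))\<close> equals 1 at
    \<open>t1\<close> and is at least 1 beyond it.\<close>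
  define C where "C = 1 / (1 - exp (- k * t1))"
  have e1: "exp (- k * t1) < 1" using k t1 by (simp add: mult_pos_pos)
  have C: "C \<ge> 1" unfolding C_def using e1 by (simp add: field_simps)
  have bound: "1 - h t \<le> C * (1 - exp (- k * t))" if "t > 0" for t
  proof (cases "t < t1")
    case True
    have "- k * t \<le> ln (h t1) * (t / t1)"
      using that t1 by (simp add: k_def field_simps)
    then have "exp (- k * t) \<le> h t1 powr (t / t1)"
      using t1 by (simp add: powr_def mult.commute)
    also have "\<dots> \<le> h t" using h_ray[OF that True] .
    finally have "1 - h t \<le> 1 - exp (- k * t)" by simp
    also have "\<dots> \<le> C * (1 - exp (- k * t))"
      using C k that mult_right_mono[OF C, of "1 - exp (- k * t)"] by simp
    finally show ?thesis .
  next
    case False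
    then have "exp (- k * t) \<le> exp (- k * t1)" using k by simp
    then have "1 \<le> C * (1 - exp (- k * t))" unfolding C_def using e1 by (simp add: field_simps)
    then show ?thesis using h01(1)[of t] by linarith
  qed
  have "deficit \<le> (\<integral>\<^sup>+t. ennreal C * (indicator {0<..} t * ennreal (t powr (- b - 1) * (1 - exp (- k * t)))) \<partial>lborel)"
    unfolding deficit_def
  proof (rule nn_integral_mono)
    fix t :: real
    show "indicator {0<..} t * ennreal (t powr (- b - 1) * (1 - h t))
        \<le> ennreal C * (indicator {0<..} t * ennreal (t powr (- b - 1) * (1 - exp (- k * t))))"
    proof (cases "t > 0")
      case True
      have "t powr (- b - 1) * (1 - h t) \<le> t powr (- b - 1) * (C * (1 - exp (- k * t)))"
        by (intro mult_left_mono bound True) simp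
      also have "\<dots> = C * (t powr (- b - 1) * (1 - exp (- k * t)))" by simp
      finally show ?thesis using True C k by (simp add: ennreal_mult'[symmetric] ennreal_leI)
    qed simp
  qed
  also have "\<dots> = ennreal C * ennreal (k powr b * Gamma (1 - b) / b)"
    using one_minus_exp_integral[OF b, of k] k by (subst nn_integral_cmult) simp_all
  also have "\<dots> < \<infinity>" by (simp add: ennreal_mult_less_top)
  finally show ?thesis .
qed

text \<open>Since \<open>ln h\<close> is concave and vanishes at \<open>0\<close>, \<open>h t - exp (- c * t)\<close> changes sign at most once,
  from plus to minus, at some \<open>t0\<close>; hence \<open>(t powr (p + b) - t0 powr (p + b)) * (h t - exp (- c * t)) \<le> 0\<close>.\<close>

lemma moment_le:
  fixes p :: real
  assumes p: "p > 0" and c: "c > 0" and def: "deficit = ennreal (c powr b * Gamma (1 - b) / b)"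
  shows "(\<integral>\<^sup>+t. indicator {0<..} t * ennreal (t powr (p - 1) * h t) \<partial>lborel) \<le> ennreal (Gamma p * c powr (- p))"
proof -
  define A where "A = {t. t > 0 \<and> h t < exp (- c * t)}"
  \<comment> \<open>Once below the exponential, \<open>h\<close> stays below: if \<open>h t\<close>
    were at least \<open>exp (- c * t)\<close>, raising to the power \<open>a / t\<close> would give
    the same at \<open>a\<close> by \<open>h_ray\<close>.\<close>
  have up: "t \<in> A" if a: "a \<in> A" and t: "a < t" for a t
  proof (rule ccontr)
    assume "t \<notin> A"
    have a0: "0 < a" "h a < exp (- c * a)" using a by (auto simp: A_def)
    then have "exp (- c * t) \<le> h t" using t \<open>t \<notin> A\<close> by (auto simp: A_def)
    then have "exp (- c * t) powr (a / t) \<le> h t powr (a / t)"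
      using a0 t by (intro powr_mono2) auto
    also have "\<dots> \<le> h a" using h_ray a0 t by simp
    finally have "exp (- c * a) \<le> h a" using a0 t by (simp add: powr_def mult.commute)
    then show False using a0 by simp
  qed
  have E: "(\<integral>\<^sup>+t. indicator {0<..} t * ennreal (t powr (- b - 1) * (1 - exp (- c * t))) \<partial>lborel) = deficit"
    unfolding def by (rule one_minus_exp_integral[OF b c])
  have fin: "deficit < \<infinity>" by (simp add: def)
  show ?thesis
  proof (cases "A = {}")
    case True
    then have ge: "exp (- c * t) \<le> h t" if "t > 0" for t
      using that unfolding A_def by (metis (mono_tags, lifting) empty_iff mem_Collect_eq not_less)
    \<comment> \<open>Here \<open>h\<close> dominates the exponential on the whole half-line. As
      their deficits are equal and finite, the two agree almost everywhere.\<close>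
    let ?D = "\<integral>\<^sup>+t. indicator {0<..} t * ennreal (t powr (- b - 1) * (h t - exp (- c * t))) \<partial>lborel"
    have "deficit = (\<integral>\<^sup>+t. indicator {0<..} t * ennreal (t powr (- b - 1) * (1 - h t))
          + indicator {0<..} t * ennreal (t powr (- b - 1) * (h t - exp (- c * t))) \<partial>lborel)"
      unfolding E[symmetric]
    proof (rule nn_integral_cong)
      fix t :: real
      show "indicator {0<..} t * ennreal (t powr (- b - 1) * (1 - exp (- c * t)))
          = indicator {0<..} t * ennreal (t powr (- b - 1) * (1 - h t))
          + indicator {0<..} t * ennreal (t powr (- b - 1) * (h t - exp (- c * t)))"
        using ge[of t] h01[of t] 
        by (cases "t > 0") (auto simp: ennreal_plus[symmetric] distrib_left[symmetric] simp del: ennreal_plus)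
    qed
    also have "\<dots> = deficit + ?D"
      unfolding deficit_def by (rule nn_integral_add) measurable
    finally have "?D = 0"
      using fin by (metis add.right_neutral add_left_imp_eq ennreal_add_left_cancel infinity_ennreal_def less_irrefl)
    then have "AE t in lborel. indicator {0<..} t * ennreal (t powr (- b - 1) * (h t - exp (- c * t))) = 0"
      by (subst (asm) nn_integral_0_iff_AE) auto
    then have "AE t in lborel. t > 0 \<longrightarrow> h t = exp (- c * t)"
    proof eventually_elim
      case (elim t)
      show ?case
      proof
        assume "t > 0"
        then have "t powr (- b - 1) * (h t - exp (- c * t)) \<le> 0"
          using elim by (simp add: ennreal_eq_0_iff)
        then show "h t = exp (- c * t)"
          using ge[OF \<open>t > 0\<close>] \<open>t > 0\<close> by (simp add: mult_le_0_iff)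
      qed
    qed
    then have "(\<integral>\<^sup>+t. indicator {0<..} t * ennreal (t powr (p - 1) * h t) \<partial>lborel)
        = (\<integral>\<^sup>+t. indicator {0<..} t * ennreal (t powr (p - 1) * exp (- c * t)) \<partial>lborel)"
      by (intro nn_integral_cong_AE) (auto elim!: eventually_mono simp: indicator_def)
    then show ?thesis using Gamma_nn_integral_scaled[OF p c] by simp
  next
    case False
    define t0 where "t0 = Inf A"
    have t0: "t0 \<ge> 0" unfolding t0_def using False by (intro cInf_greatest) (auto simp: A_def)
    have bdd: "bdd_below A" by (rule bdd_belowI[of _ 0]) (auto simp: A_def)
    have below: "exp (- c * t) \<le> h t" if "0 < t" "t < t0" for t
      using that cInf_lower[OF _ bdd, of t] unfolding t0_def by (force simp: A_def not_less)
    have above: "h t \<le> exp (- c * t)" if "t0 < t" for t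
    proof -
      obtain a where "a \<in> A" "a < t" using \<open>t0 < t\<close> cInf_less_iff[OF False bdd] unfolding t0_def by auto
      then have "t \<in> A" by (rule up)
      then show ?thesis by (simp add: A_def)
    qed
    \<comment> \<open>Since \<open>t powr (p - 1)\<close> is
      \<open>t powr (p + b) * t powr (- b - 1)\<close>, adding \<open>T\<close> times the deficit
      integrand to each moment integrand makes their difference a nonnegative weight times the
      product with the sign change. The deficits agree, so \<open>T\<close> times the deficit
      cancels after integration. If \<open>t0 = 0\<close>, then \<open>T = 0\<close> as
      well.\<close>
    define T where "T = t0 powr (p + b)"
    have pt: "t powr (p - 1) * h t + T * (t powr (- b - 1) * (1 - h t))
        \<le> t powr (p - 1) * exp (- c * t) + T * (t powr (- b - 1) * (1 - exp (- c * t)))" if t: "t > 0" for t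
    proof -
      have "t powr (p - 1) = t powr (p + b) * t powr (- b - 1)"
        using t by (simp add: powr_add[symmetric])
      moreover have "(t powr (p + b) - T) * (h t - exp (- c * t)) \<le> 0"
      proof (cases t t0 rule: linorder_cases)
        case less
        then have "t powr (p + b) \<le> T" unfolding T_def using t p b by (intro powr_mono2) auto
        then show ?thesis using below[OF t less] by (simp add: mult_le_0_iff)
      next
        case greater
        then have "T \<le> t powr (p + b)" unfolding T_def using t0 p b by (intro powr_mono2) auto
        then show ?thesis using above[OF greater] by (simp add: mult_le_0_iff)
      qed (simp add: T_def)
      then have "t powr (- b - 1) * ((t powr (p + b) - T) * (h t - exp (- c * t))) \<le> 0"
        by (rule mult_nonneg_nonpos[OF powr_ge_zero])
      ultimately show ?thesis by (simp add: algebra_simps)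
    qed
    let ?N = "\<integral>\<^sup>+t. indicator {0<..} t * ennreal (t powr (p - 1) * h t) \<partial>lborel"
    have T: "T \<ge> 0" by (simp add: T_def)
    have split: "(\<integral>\<^sup>+t. indicator {0<..} t * ennreal (t powr (p - 1) * u t + T * (t powr (- b - 1) * (1 - u t))) \<partial>lborel)
       = (\<integral>\<^sup>+t. indicator {0<..} t * ennreal (t powr (p - 1) * u t) \<partial>lborel)
         + ennreal T * (\<integral>\<^sup>+t. indicator {0<..} t * ennreal (t powr (- b - 1) * (1 - u t)) \<partial>lborel)"
      if [measurable]: "u \<in> borel_measurable borel" and u: "\<And>t. t > 0 \<Longrightarrow> 0 \<le> u t \<and> u t \<le> 1" for u :: "real \<Rightarrow> real"
    proof -
      have "(\<integral>\<^sup>+t. indicator {0<..} t * ennreal (t powr (p - 1) * u t + T * (t powr (- b - 1) * (1 - u t))) \<partial>lborel)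
       = (\<integral>\<^sup>+t. indicator {0<..} t * ennreal (t powr (p - 1) * u t)
          + ennreal T * (indicator {0<..} t * ennreal (t powr (- b - 1) * (1 - u t))) \<partial>lborel)"
      proof (rule nn_integral_cong)
        fix t :: real
        show "indicator {0<..} t * ennreal (t powr (p - 1) * u t + T * (t powr (- b - 1) * (1 - u t)))
          = indicator {0<..} t * ennreal (t powr (p - 1) * u t)
          + ennreal T * (indicator {0<..} t * ennreal (t powr (- b - 1) * (1 - u t)))"
          using u[of t] T by (cases "t > 0") (auto simp: ennreal_mult' )
      qed
      then show ?thesis by (simp add: nn_integral_add nn_integral_cmult)
    qed
    have "?N + ennreal T * deficit
      = (\<integral>\<^sup>+t. indicator {0<..} t * ennreal (t powr (p - 1) * h t + T * (t powr (- b - 1) * (1 - h t))) \<partial>lborel)"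
      unfolding deficit_def using h01 by (subst split) auto
    also have "\<dots> \<le> (\<integral>\<^sup>+t. indicator {0<..} t * ennreal (t powr (p - 1) * exp (- c * t) + T * (t powr (- b - 1) * (1 - exp (- c * t)))) \<partial>lborel)"
      using pt by (intro nn_integral_mono) (auto simp: indicator_def intro!: ennreal_leI)
    also have "\<dots> = ennreal (Gamma p * c powr (- p)) + ennreal T * deficit"
      using c by (subst split) (auto simp only: E Gamma_nn_integral_scaled[OF p c], auto)
    finally show ?thesis
      using fin by (auto simp: add.commute ennreal_add_left_cancel_le ennreal_mult_eq_top_iff)
  qed
qed

end

section \<open>Simplices with a vertex at the origin\<close>

text \<open>An extreme point of a convex hull is one of its generators, so 0 is a vertex. Affine
  independence of the vertices is then linear independence of the others, and their number makes
  them a basis.\<close>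

lemma simplex_at_origin_basis:
  fixes \<Delta> :: "'a::euclidean_space set"
  assumes "DIM('a) simplex \<Delta>" "0 extreme_point_of \<Delta>"
  obtains B where "finite B" "independent B" "span B = UNIV" "\<Delta> = convex hull (insert 0 B)" "0 \<notin> B"
proof -
  obtain C where C: "finite C" "\<not> affine_dependent C" "int (card C) = int DIM('a) + 1" "\<Delta> = convex hull C"
    using assms(1) by (auto simp: simplex)
  have "0 \<in> C" using assms(2) C(4) extreme_point_of_convex_hull by blast
  define B where "B = C - {0}"
  have CB: "C = insert 0 B" "0 \<notin> B" using \<open>0 \<in> C\<close> by (auto simp: B_def)
  have ind: "independent B" using C(2) CB affine_dependent_iff_dependent[of 0 B] by simp
  have "card B = DIM('a)" using C(3) card_Diff_singleton[OF \<open>0 \<in> C\<close>] by (simp add: B_def)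
  then have "span B = UNIV"
    using card_ge_dim_independent[of B UNIV] ind by (auto simp: dim_UNIV)
  then show thesis using that[of B] C(1,4) CB ind by auto
qed

locale simplex_coords =
  fixes B :: "'a::euclidean_space set"
  assumes fin: "finite B" and ind: "independent B" and sp: "span B = UNIV" and zero: "0 \<notin> B"
begin

abbreviation coord where "coord x b \<equiv> representation B x b"

text \<open>A linear functional on the whole space that agrees with the gauge of the simplex on the
  cone spanned by \<open>B\<close>.\<close>

definition csum where "csum x = (\<Sum>b\<in>B. coord x b)"

lemma coord_add: "coord (x + y) b = coord x b + coord y b"
  using representation_add[OF ind, of y x] sp by simp

lemma coord_scale: "coord (c *\<^sub>R x) b = c * coord x b"
  using representation_scale[OF ind, of x c] sp by simp

lemma csum_add: "csum (x + y) = csum x + csum y"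
  by (simp add: csum_def coord_add sum.distrib)

lemma csum_scale: "csum (c *\<^sub>R x) = c * csum x"
  by (simp add: csum_def coord_scale sum_distrib_left)

lemma coord_sum:
  assumes "b \<in> B"
  shows "coord (\<Sum>b\<in>B. u b *\<^sub>R b) b = u b"
proof -
  have "representation B (\<Sum>b\<in>B. u b *\<^sub>R b) = (\<lambda>b. if b \<in> B then u b else 0)"
  proof (rule representation_eqI[OF ind])
    show "(\<Sum>b | (if b \<in> B then u b else 0) \<noteq> 0. (if b \<in> B then u b else 0) *\<^sub>R b) = (\<Sum>b\<in>B. u b *\<^sub>R b)"
      by (rule sum.mono_neutral_cong_left[OF fin]) (auto split: if_splits)
  qed (use sp in \<open>auto intro: finite_subset[OF _ fin] split: if_splits\<close>)
  then show ?thesis using assms by simp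
qed

lemma sum_coord: "(\<Sum>b\<in>B. coord x b *\<^sub>R b) = x"
  using sum_representation_eq[OF ind, of x B] sp fin by simp

lemma mem_scaled_simplex:
  assumes l: "l > 0"
  shows "x \<in> (\<lambda>y. l *\<^sub>R y) ` (convex hull (insert 0 B)) \<longleftrightarrow> (\<forall>b\<in>B. 0 \<le> coord x b) \<and> csum x \<le> l"
proof
  assume "x \<in> (\<lambda>y. l *\<^sub>R y) ` (convex hull (insert 0 B))"
  then obtain y where y: "x = l *\<^sub>R y" "y \<in> convex hull (insert 0 B)" by blast
  then obtain u where u: "\<And>b. b \<in> insert 0 B \<Longrightarrow> 0 \<le> u b" "sum u (insert 0 B) = 1" "(\<Sum>b\<in>insert 0 B. u b *\<^sub>R b) = y"
    using fin unfolding convex_hull_finite[OF finite.insertI[OF fin]] by auto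
  have "y = (\<Sum>b\<in>B. u b *\<^sub>R b)" using u(3) fin zero by simp
  then have c: "coord x b = l * u b" if "b \<in> B" for b
    using coord_sum[OF that, of u] y(1) by (simp add: coord_scale)
  have "csum x = l * sum u B" using c by (simp add: csum_def sum_distrib_left)
  moreover have "sum u B \<le> 1" using u(1)[of 0] u(2) fin zero by simp
  ultimately show "(\<forall>b\<in>B. 0 \<le> coord x b) \<and> csum x \<le> l"
    using c u(1) l by (auto simp: mult_le_cancel_left1)
next
  assume a: "(\<forall>b\<in>B. 0 \<le> coord x b) \<and> csum x \<le> l"
  \<comment> \<open>Barycentric coordinates of \<open>x\<close> divided by \<open>l\<close>; the
    vertex 0 takes up the remaining weight.\<close>
  define u where "u b = (if b = 0 then 1 - csum x / l else coord x b / l)" for b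
  have uB: "u b = coord x b / l" if "b \<in> B" for b using that zero by (auto simp: u_def)
  have "sum u B = csum x / l" using uB by (simp add: csum_def sum_divide_distrib)
  have "(1 / l) *\<^sub>R x = (\<Sum>b\<in>insert 0 B. u b *\<^sub>R b)"
  proof -
    have "(\<Sum>b\<in>insert 0 B. u b *\<^sub>R b) = (\<Sum>b\<in>B. (1 / l) *\<^sub>R (coord x b *\<^sub>R b))"
      using fin zero uB by simp
    also have "\<dots> = (1 / l) *\<^sub>R x" by (simp only: scaleR_sum_right[symmetric] sum_coord)
    finally show ?thesis by simp
  qed
  moreover have "sum u (insert 0 B) = 1" using fin zero \<open>sum u B = csum x / l\<close> by (simp add: u_def)
  moreover have "\<forall>b\<in>insert 0 B. 0 \<le> u b" using a l by (auto simp: u_def)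
  ultimately have "(1 / l) *\<^sub>R x \<in> convex hull (insert 0 B)"
    unfolding convex_hull_finite[OF finite.insertI[OF fin]] by (auto intro!: exI[of _ u])
  then show "x \<in> (\<lambda>y. l *\<^sub>R y) ` (convex hull (insert 0 B))"
    using l by (intro image_eqI[of _ _ "(1 / l) *\<^sub>R x"]) auto
qed

lemma gauge_fn_simplex:
  "gauge_fn (convex hull (insert 0 B)) x = (if \<forall>b\<in>B. 0 \<le> coord x b then ereal (csum x) else \<infinity>)"
proof (cases "\<forall>b\<in>B. 0 \<le> coord x b")
  case True
  have set: "{ereal l |l. 0 < l \<and> x \<in> (\<lambda>y. l *\<^sub>R y) ` (convex hull (insert 0 B))} = {ereal l |l. 0 < l \<and> csum x \<le> l}"
    using True mem_scaled_simplex by blast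
  have "csum x \<ge> 0" using True by (auto simp: csum_def intro: sum_nonneg)
  have "Inf {ereal l |l. 0 < l \<and> csum x \<le> l} = ereal (csum x)"
  proof (rule antisym)
    show "Inf {ereal l |l. 0 < l \<and> csum x \<le> l} \<le> ereal (csum x)"
    \<comment> \<open>If \<open>csum x = 0\<close> the infimum is not attained, because the scaling
      factors are strictly positive.\<close>
    proof (rule ereal_le_epsilon2)
      fix e :: real assume "0 < e"
      then have "ereal (csum x + e) \<in> {ereal l |l. 0 < l \<and> csum x \<le> l}" using \<open>csum x \<ge> 0\<close> by auto
      from Inf_lower[OF this] show "Inf {ereal l |l. 0 < l \<and> csum x \<le> l} \<le> ereal (csum x) + ereal e"
        by (simp only: plus_ereal.simps)
    qed
    show "ereal (csum x) \<le> Inf {ereal l |l. 0 < l \<and> csum x \<le> l}"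
      by (auto intro!: Inf_greatest)
  qed
  then show ?thesis using True unfolding gauge_fn_def set by simp
next
  case False
  then have "{ereal l |l. 0 < l \<and> x \<in> (\<lambda>y. l *\<^sub>R y) ` (convex hull (insert 0 B))} = {}"
    using mem_scaled_simplex by blast
  then have "gauge_fn (convex hull (insert 0 B)) x = \<infinity>"
    unfolding gauge_fn_def by (simp only: Inf_empty top_ereal_def)
  then show ?thesis using False by (simp only: if_False)
qed

definition negpart where "negpart y = (\<Sum>b\<in>B. max 0 (- coord y b) *\<^sub>R b)"

lemma coord_negpart: "b \<in> B \<Longrightarrow> coord (negpart y) b = max 0 (- coord y b)"
  unfolding negpart_def by (rule coord_sum)

lemma negpart_scale: "t \<ge> 0 \<Longrightarrow> negpart (t *\<^sub>R y) = t *\<^sub>R negpart y"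
  unfolding negpart_def scaleR_sum_right
  by (intro sum.cong refl) (simp add: coord_scale max_mult_distrib_left)

text \<open>Adding twice its negative part to a number gives its absolute value, so this expression
  is the sum of the absolute values of the coordinates of \<open>y\<close>. It turns out to be the
  decay rate of the autocorrelation.\<close>

lemma csum_negpart: "csum y + 2 * csum (negpart y) \<ge> 0"
  unfolding csum_def sum_distrib_left sum.distrib[symmetric]
  by (intro sum_nonneg) (simp add: coord_negpart max_def)

definition cone_exp :: "real \<Rightarrow> 'a \<Rightarrow> real" where
  "cone_exp a x = (if \<forall>b\<in>B. 0 \<le> coord x b then a * exp (- csum x) else 0)"

text \<open>The cone intersected with its translate by \<open>- y\<close> is the cone translated by \<open>negpart y\<close>.\<close>

lemma cone_exp_product:
  "cone_exp a (x + negpart y) * cone_exp a (x + negpart y + y)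
    = exp (- (csum y + 2 * csum (negpart y))) * (cone_exp a x * cone_exp a x)"
proof -
  have iff: "(\<forall>b\<in>B. 0 \<le> coord (x + negpart y) b) \<and> (\<forall>b\<in>B. 0 \<le> coord (x + negpart y + y) b) \<longleftrightarrow> (\<forall>b\<in>B. 0 \<le> coord x b)"
  proof -
    have "0 \<le> coord (x + negpart y) b \<and> 0 \<le> coord (x + negpart y + y) b \<longleftrightarrow> 0 \<le> coord x b" if "b \<in> B" for b
      using that by (auto simp: coord_add coord_negpart max_def)
    then show ?thesis by blast
  qed
  show ?thesis
  proof (cases "\<forall>b\<in>B. 0 \<le> coord x b")
    case True
    then have "cone_exp a x = a * exp (- csum x)"
      "cone_exp a (x + negpart y) = a * exp (- (csum x + csum (negpart y)))"
      "cone_exp a (x + negpart y + y) = a * exp (- (csum x + csum (negpart y) + csum y))"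
      using iff unfolding cone_exp_def csum_add by (metis (no_types, lifting))+
    then have "cone_exp a (x + negpart y) * cone_exp a (x + negpart y + y)
        = a * a * (exp (- (csum x + csum (negpart y))) * exp (- (csum x + csum (negpart y) + csum y)))"
      by simp
    also have "exp (- (csum x + csum (negpart y))) * exp (- (csum x + csum (negpart y) + csum y))
        = exp (- (csum y + 2 * csum (negpart y))) * (exp (- csum x) * exp (- csum x))"
      by (simp only: exp_add[symmetric]) simp
    finally show ?thesis using \<open>cone_exp a x = a * exp (- csum x)\<close> by simp
  next
    case False
    then have "cone_exp a x = 0" unfolding cone_exp_def by (rule if_not_P)
    moreover have "cone_exp a (x + negpart y) = 0 \<or> cone_exp a (x + negpart y + y) = 0"
      using False iff unfolding cone_exp_def by (metis (no_types, lifting))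
    ultimately show ?thesis by auto
  qed
qed

end

section \<open>Comparison of the volume with the norms\<close>

context nontrivial_log_concave begin

context
  fixes \<alpha> :: real
  assumes \<alpha>: "0 < \<alpha>" "\<alpha> < 1/2"
begin

lemma ray_profile_autocorr: "ray_profile (\<lambda>t. autocorr (t *\<^sub>R \<xi>) / autocorr 0) (2 * \<alpha>)"
proof
  fix s t :: real assume st: "0 < s" "s < t"
  then have "(s / t) *\<^sub>R (t *\<^sub>R \<xi>) = s *\<^sub>R \<xi>" by simp
  then show "(autocorr (t *\<^sub>R \<xi>) / autocorr 0) powr (s / t) \<le> autocorr (s *\<^sub>R \<xi>) / autocorr 0"
    using autocorr_log_concave_ray[of "s / t" "t *\<^sub>R \<xi>"] st by simp
qed (use \<alpha> autocorr_nonneg autocorr_0_pos integral_shift_diff_sq(2) in \<open>auto simp: divide_le_eq_1\<close>)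

abbreviation ray_deficit where
  "ray_deficit \<xi> \<equiv> ray_profile.deficit (\<lambda>t. autocorr (t *\<^sub>R \<xi>) / autocorr 0) (2 * \<alpha>)"

lemma Pi_integral_autocorr:
  "Pi_integral \<alpha> f \<xi> = (\<integral>\<^sup>+t. indicator {0<..} t * ennreal (t powr (-2 * \<alpha> - 1)) *
     ennreal (2 * (autocorr 0 - autocorr (t *\<^sub>R \<xi>))) \<partial>lborel)"
  unfolding Pi_integral_def nn_integral_completion integral_shift_diff_sq(1) ..

lemma Pi_integral_deficit: "Pi_integral \<alpha> f \<xi> = ennreal (2 * autocorr 0) * ray_deficit \<xi>"
proof -
  have "Pi_integral \<alpha> f \<xi> = (\<integral>\<^sup>+t. ennreal (2 * autocorr 0) * (indicator {0<..} t *
      ennreal (t powr (- (2 * \<alpha>) - 1) * (1 - autocorr (t *\<^sub>R \<xi>) / autocorr 0))) \<partial>lborel)"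
    unfolding Pi_integral_autocorr
  proof (rule nn_integral_cong)
    fix t :: real
    have "2 * (autocorr 0 - autocorr (t *\<^sub>R \<xi>)) = 2 * autocorr 0 * (1 - autocorr (t *\<^sub>R \<xi>) / autocorr 0)"
      using autocorr_0_pos by (simp add: field_simps)
    moreover have "1 - autocorr (t *\<^sub>R \<xi>) / autocorr 0 \<ge> 0"
      using autocorr_0_pos integral_shift_diff_sq(2) by (simp add: divide_le_eq_1)
    ultimately show "indicator {0<..} t * ennreal (t powr (-2 * \<alpha> - 1)) * ennreal (2 * (autocorr 0 - autocorr (t *\<^sub>R \<xi>)))
      = ennreal (2 * autocorr 0) * (indicator {0<..} t * ennreal (t powr (- (2 * \<alpha>) - 1) * (1 - autocorr (t *\<^sub>R \<xi>) / autocorr 0)))"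
      using autocorr_0_pos by (simp add: ennreal_mult ac_simps)
  qed
  also have "\<dots> = ennreal (2 * autocorr 0) * ray_deficit \<xi>"
    unfolding ray_profile.deficit_def[OF ray_profile_autocorr] by (rule nn_integral_cmult) measurable
  finally show ?thesis .
qed

lemma Pi_star_borel [measurable]: "Pi_star \<alpha> f \<in> sets borel"
proof -
  have [measurable]: "Pi_integral \<alpha> f \<in> borel_measurable borel"
    unfolding Pi_integral_autocorr by measurable
  have [measurable]: "Pi_radial \<alpha> f \<in> borel_measurable borel"
    unfolding Pi_radial_def Let_def by measurable
  have "Measurable.pred borel (\<lambda>x. x = 0 \<or> ennreal (norm x) \<le> Pi_radial \<alpha> f (x /\<^sub>R norm x))"
    by measurable
  then show ?thesis unfolding Pi_star_def by simp
qed

lemma ray_integral_Pi_star: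
  assumes "norm \<xi> = 1"
  shows "ray_integral (indicator (Pi_star \<alpha> f)) \<xi>
    = (\<integral>\<^sup>+s. indicator {0<..} s * ennreal (s ^ (DIM('a) - 1)) * indicator {s. ennreal s \<le> Pi_radial \<alpha> f \<xi>} s \<partial>lborel)"
  unfolding ray_integral_def
proof (rule nn_integral_cong)
  fix s :: real
  show "indicator {0<..} s * ennreal (s ^ (DIM('a) - 1)) * indicator (Pi_star \<alpha> f) (s *\<^sub>R \<xi>)
    = indicator {0<..} s * ennreal (s ^ (DIM('a) - 1)) * indicator {s. ennreal s \<le> Pi_radial \<alpha> f \<xi>} s"
    using assms by (cases "s > 0") (auto simp: indicator_def Pi_star_def)
qed

text \<open>Normalized such that an exponential profile of rate \<open>c\<close> has
  \<open>Pi_integral\<close> equal to \<open>c powr (2 * \<alpha>) / kappa\<close>, hence radial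
  function \<open>kappa powr (1 / (2 * \<alpha>)) / c\<close>.\<close>

definition kappa where "kappa = \<alpha> / (autocorr 0 * Gamma (1 - 2 * \<alpha>))"

text \<open>The quotient, for an exponential profile, of the ray integral of the autocorrelation by
  that of the indicator of \<open>Pi_star\<close>. The former is
  \<open>autocorr 0 * Gamma n * c powr (- n)\<close> and the latter is the \<open>n\<close>-th power
  of the radial function over \<open>n\<close>, with \<open>n\<close> the dimension, so the rate
  \<open>c\<close> cancels.\<close>

definition ratio where
  "ratio = autocorr 0 * Gamma (real DIM('a) + 1) * kappa powr (- real DIM('a) / (2 * \<alpha>))"

lemma kappa_pos: "kappa > 0"
  unfolding kappa_def using \<alpha> autocorr_0_pos Gamma_real_pos[of "1 - 2 * \<alpha>"] by simp

lemma ratio_pos: "ratio > 0"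
  unfolding ratio_def using autocorr_0_pos kappa_pos Gamma_real_pos[of "real DIM('a) + 1"]
  by (simp add: mult_pos_pos add_nonneg_pos)

text \<open>Zero deficit makes the radial function infinite: the whole ray belongs to
  \<open>Pi_star\<close>, and the weight has infinite integral along it.\<close>

lemma ray_integral_Pi_star_deficit_0:
  assumes "norm \<xi> = 1" "ray_deficit \<xi> = 0"
  shows "ennreal ratio * ray_integral (indicator (Pi_star \<alpha> f)) \<xi> = \<infinity>"
proof -
  have "Pi_radial \<alpha> f \<xi> = \<infinity>" using assms(2) by (simp add: Pi_radial_def Pi_integral_deficit)
  then have "ray_integral (indicator (Pi_star \<alpha> f)) \<xi> = \<infinity>"
    unfolding ray_integral_Pi_star[OF assms(1)] using monomial_integral_infinite by simp
  then show ?thesis using ratio_pos by (simp add: ennreal_mult_eq_top_iff)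
qed

text \<open>Expresses the contribution of a ray to the volume through the rate \<open>c\<close> of
  the exponential with the same deficit. The right side is the ray integral of that exponential,
  scaled by \<open>autocorr 0\<close>, and so is ready for comparison with the
  autocorrelation.\<close>

lemma ray_integral_Pi_star_finite:
  assumes \<xi>: "norm \<xi> = 1" and c: "c > 0"
    and def: "ray_deficit \<xi> = ennreal (c powr (2 * \<alpha>) * Gamma (1 - 2 * \<alpha>) / (2 * \<alpha>))"
  shows "ennreal ratio * ray_integral (indicator (Pi_star \<alpha> f)) \<xi>
    = ennreal (autocorr 0) * ennreal (Gamma (real DIM('a)) * c powr (- real DIM('a)))"
proof -
  let ?n = "real DIM('a)"
  have G: "Gamma (1 - 2 * \<alpha>) > 0" using \<alpha> by (intro Gamma_real_pos) simp
  define i where "i = c powr (2 * \<alpha>) / kappa"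
  have i: "i > 0" using c kappa_pos by (simp add: i_def)
  have "Pi_integral \<alpha> f \<xi> = ennreal (2 * autocorr 0 * (c powr (2 * \<alpha>) * Gamma (1 - 2 * \<alpha>) / (2 * \<alpha>)))"
    unfolding Pi_integral_deficit def using autocorr_0_pos G \<alpha> by (subst ennreal_mult) auto
  also have "2 * autocorr 0 * (c powr (2 * \<alpha>) * Gamma (1 - 2 * \<alpha>) / (2 * \<alpha>)) = i"
    using autocorr_0_pos G \<alpha> by (simp add: i_def kappa_def)
  finally have I: "Pi_integral \<alpha> f \<xi> = ennreal i" .
  define r where "r = i powr (-1 / (2 * \<alpha>))"
  have r: "r > 0" using i by (simp add: r_def)
  have "Pi_radial \<alpha> f \<xi> = ennreal r"
    using I i by (simp add: Pi_radial_def r_def)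
  then have "ray_integral (indicator (Pi_star \<alpha> f)) \<xi>
      = (\<integral>\<^sup>+s. indicator {0<..} s * ennreal (s ^ (DIM('a) - 1)) * indicator {s. ennreal s \<le> ennreal r} s \<partial>lborel)"
    unfolding ray_integral_Pi_star[OF \<xi>] by simp
  also have "\<dots> = (\<integral>\<^sup>+s. ennreal (s ^ (DIM('a) - 1)) * indicator {0..r} s \<partial>lborel)"
  proof (rule nn_integral_cong_AE)
    have "AE s in lborel. (s::real) \<noteq> 0" by (rule AE_lborel_singleton)
    then show "AE s in lborel. indicator {0<..} s * ennreal (s ^ (DIM('a) - 1)) * indicator {s. ennreal s \<le> ennreal r} s
      = ennreal (s ^ (DIM('a) - 1)) * indicator {0..r} s"
      by eventually_elim (use r in \<open>auto simp: indicator_def\<close>)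
  qed
  also have "\<dots> = ennreal (r ^ DIM('a) / ?n - 0 ^ DIM('a) / ?n)"
  proof (rule nn_integral_FTC_Icc)
    fix s :: real assume s: "s \<in> {0..r}"
    show "DERIV (\<lambda>s. s ^ DIM('a) / ?n) s :> s ^ (DIM('a) - 1)"
      by (auto intro!: derivative_eq_intros)
    show "0 \<le> s ^ (DIM('a) - 1)" using s by simp
  qed (use r in auto)
  finally have R: "ray_integral (indicator (Pi_star \<alpha> f)) \<xi> = ennreal (r powr ?n / ?n)"
    using r by (simp add: powr_realpow zero_power)
  define q where "q = kappa powr (- ?n / (2 * \<alpha>))"
  have q: "q > 0" using kappa_pos by (simp add: q_def)
  have "r powr ?n = i powr (- ?n / (2 * \<alpha>))"
    by (simp add: r_def powr_powr)
  also have "\<dots> = (c powr (2 * \<alpha>)) powr (- ?n / (2 * \<alpha>)) / q"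
    unfolding i_def q_def by (rule powr_divide)
  also have "(c powr (2 * \<alpha>)) powr (- ?n / (2 * \<alpha>)) = c powr (- ?n)"
    using \<alpha>(1) by (simp add: powr_powr)
  finally have rn: "r powr ?n = c powr (- ?n) / q" .
  have Gn: "Gamma (?n + 1) = ?n * Gamma ?n"
    by (rule Gamma_plus1) (use nonpos_Ints_nonpos[of ?n] DIM_positive[where 'a='a] in force)
  have "ratio * (r powr ?n / ?n) = autocorr 0 * (Gamma ?n * c powr (- ?n))"
    unfolding ratio_def rn Gn q_def[symmetric] using q by simp
  then show ?thesis
    unfolding R using ratio_pos autocorr_0_pos by (simp add: ennreal_mult'[symmetric])
qed

lemma ray_integral_autocorr:
  "ray_integral (\<lambda>x. ennreal (autocorr x)) \<xi> = ennreal (autocorr 0) *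
    (\<integral>\<^sup>+t. indicator {0<..} t * ennreal (t powr (real DIM('a) - 1) * (autocorr (t *\<^sub>R \<xi>) / autocorr 0)) \<partial>lborel)"
proof -
  have "ray_integral (\<lambda>x. ennreal (autocorr x)) \<xi> = (\<integral>\<^sup>+t. ennreal (autocorr 0) *
    (indicator {0<..} t * ennreal (t powr (real DIM('a) - 1) * (autocorr (t *\<^sub>R \<xi>) / autocorr 0))) \<partial>lborel)"
    unfolding ray_integral_def
  proof (rule nn_integral_cong)
    fix t :: real
    show "indicator {0<..} t * ennreal (t ^ (DIM('a) - 1)) * ennreal (autocorr (t *\<^sub>R \<xi>))
      = ennreal (autocorr 0) * (indicator {0<..} t * ennreal (t powr (real DIM('a) - 1) * (autocorr (t *\<^sub>R \<xi>) / autocorr 0)))"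
    proof (cases "t > 0")
      case True
      have "t ^ (DIM('a) - 1) = t powr (real DIM('a) - 1)"
        using True DIM_positive[where 'a='a] by (simp add: powr_realpow[symmetric] of_nat_diff Suc_leI)
      then show ?thesis
        using True autocorr_0_pos autocorr_nonneg by (simp add: ennreal_mult'[symmetric])
    qed simp
  qed
  also have "\<dots> = ennreal (autocorr 0) *
    (\<integral>\<^sup>+t. indicator {0<..} t * ennreal (t powr (real DIM('a) - 1) * (autocorr (t *\<^sub>R \<xi>) / autocorr 0)) \<partial>lborel)"
    by (rule nn_integral_cmult) measurable
  finally show ?thesis .
qed

lemma ray_inequality:
  assumes \<xi>: "norm \<xi> = 1"
  shows "ray_integral (\<lambda>x. ennreal (autocorr x)) \<xi> \<le> ennreal ratio * ray_integral (indicator (Pi_star \<alpha> f)) \<xi>"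
proof -
  interpret ray_profile "\<lambda>t. autocorr (t *\<^sub>R \<xi>) / autocorr 0" "2 * \<alpha>" by (rule ray_profile_autocorr)
  have n: "real DIM('a) > 0" using DIM_positive[where 'a='a] by simp
  show ?thesis
  proof (cases "ray_deficit \<xi> = 0 \<or> ray_deficit \<xi> = \<infinity>")
    case True
    then show ?thesis
    proof
      assume "ray_deficit \<xi> = 0"
      then show ?thesis using ray_integral_Pi_star_deficit_0[OF \<xi>] by simp
    next
      \<comment> \<open>By \<open>deficit_finite\<close>, a single positive value on the ray would
        make the deficit finite.\<close>
      assume "ray_deficit \<xi> = \<infinity>"
      then have "autocorr (t *\<^sub>R \<xi>) = 0" if "t > 0" for t
        using deficit_finite[OF that] autocorr_0_pos autocorr_nonneg[of "t *\<^sub>R \<xi>"] by (force simp: less_le)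
      then have "ray_integral (\<lambda>x. ennreal (autocorr x)) \<xi> = (\<integral>\<^sup>+t. 0 \<partial>(lborel :: real measure))"
        unfolding ray_integral_def by (intro nn_integral_cong) (auto simp: indicator_def)
      then show ?thesis by simp
    qed
  next
    case False
    have G: "Gamma (1 - 2 * \<alpha>) > 0" using \<alpha> by (intro Gamma_real_pos) simp
    obtain j where j: "ray_deficit \<xi> = ennreal j" "j > 0"
      using False by (cases "ray_deficit \<xi>") (auto simp: less_le)
    \<comment> \<open>The value that \<open>c powr (2 * \<alpha>)\<close> must take for the
      exponential of rate \<open>c\<close> to have deficit \<open>j\<close>.\<close>
    define x where "x = 2 * \<alpha> * j / Gamma (1 - 2 * \<alpha>)"
    have x: "x > 0" unfolding x_def using \<alpha> j(2) by (intro divide_pos_pos G) simp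
    have xG: "x * Gamma (1 - 2 * \<alpha>) = 2 * \<alpha> * j"
      unfolding x_def using G by (metis less_irrefl nonzero_eq_divide_eq)
    define c where "c = x powr (1 / (2 * \<alpha>))"
    have c: "c > 0" using x by (simp add: c_def)
    have cp: "c powr (2 * \<alpha>) = x"
      using \<alpha>(1) x by (simp add: c_def powr_powr)
    have d: "ray_deficit \<xi> = ennreal (c powr (2 * \<alpha>) * Gamma (1 - 2 * \<alpha>) / (2 * \<alpha>))"
      unfolding cp xG j(1) using \<alpha>(1) by simp
    show ?thesis
      unfolding ray_integral_autocorr ray_integral_Pi_star_finite[OF \<xi> c d]
      by (intro mult_left_mono moment_le[OF n c d]) simp
  qed
qed

text \<open>The rate is now given instead of being fitted to the deficit, and the profile is its own
  comparison function. For \<open>c = 0\<close> both sides are infinite.\<close>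

lemma ray_equality:
  assumes \<xi>: "norm \<xi> = 1" and c: "c \<ge> 0"
    and e: "\<And>t. t > 0 \<Longrightarrow> autocorr (t *\<^sub>R \<xi>) = autocorr 0 * exp (- c * t)"
  shows "ray_integral (\<lambda>x. ennreal (autocorr x)) \<xi> = ennreal ratio * ray_integral (indicator (Pi_star \<alpha> f)) \<xi>"
proof -
  interpret ray_profile "\<lambda>t. autocorr (t *\<^sub>R \<xi>) / autocorr 0" "2 * \<alpha>" by (rule ray_profile_autocorr)
  have n: "real DIM('a) > 0" using DIM_positive[where 'a='a] by simp
  have h: "autocorr (t *\<^sub>R \<xi>) / autocorr 0 = exp (- c * t)" if "t > 0" for t
    using e[OF that] autocorr_0_pos by simp
  have d: "ray_deficit \<xi> = (\<integral>\<^sup>+t. indicator {0<..} t * ennreal (t powr (- (2 * \<alpha>) - 1) * (1 - exp (- c * t))) \<partial>lborel)"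
    unfolding deficit_def by (intro nn_integral_cong) (auto simp: indicator_def h)
  have m: "ray_integral (\<lambda>x. ennreal (autocorr x)) \<xi> = ennreal (autocorr 0) *
    (\<integral>\<^sup>+t. indicator {0<..} t * ennreal (t powr (real DIM('a) - 1) * exp (- c * t)) \<partial>lborel)"
    unfolding ray_integral_autocorr
  proof (rule arg_cong[where f="\<lambda>z. ennreal (autocorr 0) * z"], rule nn_integral_cong)
    fix t :: real
    show "indicator {0<..} t * ennreal (t powr (real DIM('a) - 1) * (autocorr (t *\<^sub>R \<xi>) / autocorr 0))
      = indicator {0<..} t * ennreal (t powr (real DIM('a) - 1) * exp (- c * t))"
      using h[of t] by (cases "t > 0") (simp_all only:, simp)
  qed
  show ?thesis
  proof (cases "c = 0")
    case True
    have "ray_integral (\<lambda>x. ennreal (autocorr x)) \<xi>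
        = (\<integral>\<^sup>+t. ennreal (autocorr 0) * (indicator {0<..} t * ennreal (t ^ (DIM('a) - 1))) \<partial>lborel)"
      unfolding ray_integral_def using e True by (intro nn_integral_cong) (auto simp: indicator_def mult.commute)
    also have "\<dots> = ennreal (autocorr 0) * \<infinity>"
      by (subst nn_integral_cmult) (auto simp: monomial_integral_infinite[unfolded infinity_ennreal_def, simplified])
    also have "\<dots> = \<infinity>" using autocorr_0_pos by (simp add: ennreal_mult_eq_top_iff)
    finally show ?thesis using ray_integral_Pi_star_deficit_0[OF \<xi>] d True by simp
  next
    case False
    then have c: "c > 0" using c by simp
    have d': "ray_deficit \<xi> = ennreal (c powr (2 * \<alpha>) * Gamma (1 - 2 * \<alpha>) / (2 * \<alpha>))"
      unfolding d using \<alpha> c by (intro one_minus_exp_integral) auto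
    show ?thesis
      unfolding ray_integral_Pi_star_finite[OF \<xi> c d'] m Gamma_nn_integral_scaled[OF n c] ..
  qed
qed

lemma L1_sq_le_volume:
  "(\<integral>\<^sup>+x. ennreal (f x) \<partial>lborel)\<^sup>2 \<le> ennreal ratio * emeasure lborel (Pi_star \<alpha> f)"
  using nn_integral_le_by_rays[of "\<lambda>x. ennreal (autocorr x)" "indicator (Pi_star \<alpha> f)" "ennreal ratio"] ray_inequality
  by (simp add: nn_integral_autocorr_total)

lemma L1_sq_eq_volume:
  assumes "\<And>\<xi>. norm \<xi> = 1 \<Longrightarrow> \<exists>c\<ge>0. \<forall>t>0. autocorr (t *\<^sub>R \<xi>) = autocorr 0 * exp (- c * t)"
  shows "(\<integral>\<^sup>+x. ennreal (f x) \<partial>lborel)\<^sup>2 = ennreal ratio * emeasure lborel (Pi_star \<alpha> f)"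
proof -
  have "(\<integral>\<^sup>+x. ennreal (autocorr x) \<partial>lborel) = ennreal ratio * (\<integral>\<^sup>+x. indicator (Pi_star \<alpha> f) x \<partial>lborel)"
  proof (rule nn_integral_eq_by_rays)
    fix \<xi> :: 'a assume "norm \<xi> = 1"
    then show "ray_integral (\<lambda>x. ennreal (autocorr x)) \<xi> = ennreal ratio * ray_integral (indicator (Pi_star \<alpha> f)) \<xi>"
      using assms ray_equality by blast
  qed measurable
  then show ?thesis by (simp add: nn_integral_autocorr_total)
qed

end

section \<open>Norms and interpolation between them\<close>

lemma powr_integrable:
  assumes p: "p \<ge> 1"
  shows "integrable lborel (\<lambda>x. f x powr p)"
proof -
  obtain M where M: "\<And>x. f x \<le> M" using bounded by blast
  show ?thesis
  proof (rule Bochner_Integration.integrable_bound[OF integrable_mult_right[OF integrable, of "M powr (p - 1)"]])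
    show "AE x in lborel. norm (f x powr p) \<le> norm (M powr (p - 1) * f x)"
    proof (intro AE_I2)
      fix x
      have "f x powr p = f x powr (p - 1) * f x"
        using nonneg[of x] by (cases "f x = 0") (auto simp: powr_diff)
      also have "\<dots> \<le> M powr (p - 1) * f x"
        using M[of x] nonneg[of x] p by (intro mult_right_mono powr_mono2) auto
      finally show "norm (f x powr p) \<le> norm (M powr (p - 1) * f x)"
        using nonneg[of x] by simp
    qed
  qed measurable
qed

lemma powr_integral_pos:
  assumes p: "p \<ge> 1"
  shows "(\<integral>x. f x powr p \<partial>lborel) > 0"
proof (rule ccontr)
  assume "\<not> ?thesis"
  moreover have "(\<integral>x. f x powr p \<partial>lborel) \<ge> 0" by simp
  ultimately have "(\<integral>x. f x powr p \<partial>lborel) = 0" by linarith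
  then have "AE x in lborel. f x powr p = 0"
    by (subst (asm) integral_nonneg_eq_0_iff_AE) (auto intro: powr_integrable p)
  then have "AE x in lborel. (f x)\<^sup>2 = 0" by eventually_elim simp
  then have "(\<integral>x. (f x)\<^sup>2 \<partial>lborel) = (\<integral>x. 0 \<partial>(lborel :: 'a measure))" by (intro integral_cong_AE) auto
  then show False using autocorr_0_pos by (simp add: autocorr_0)
qed

lemma Lp_norm_eq:
  assumes "p \<ge> 1"
  shows "Lp_norm p f = (\<integral>x. f x powr p \<partial>lborel) powr (1 / p)"
proof -
  have "(\<integral>\<^sup>+x. ennreal (\<bar>f x\<bar> powr p) \<partial>lborel) = ennreal (\<integral>x. f x powr p \<partial>lborel)"
    using nonneg by (subst nn_integral_eq_integral[symmetric]) (auto intro: powr_integrable assms)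
  then show ?thesis unfolding Lp_norm_def nn_integral_completion by simp
qed

text \<open>Hoelder's inequality in pointwise form: Young's inequality with weights \<open>a\<close>
  and \<open>b\<close> for \<open>f x / A\<close> and \<open>f x powr p / C\<close>, each of which
  has integral 1.\<close>

lemma interpolation:
  fixes a b p :: real
  assumes p: "p \<ge> 1" and ab: "0 \<le> a" "0 \<le> b" "a + b = 1" "a + p * b = 2"
  shows "autocorr 0 \<le> (\<integral>x. f x \<partial>lborel) powr a * (\<integral>x. f x powr p \<partial>lborel) powr b"
proof -
  define A where "A = (\<integral>x. f x \<partial>lborel)"
  define C where "C = (\<integral>x. f x powr p \<partial>lborel)"
  have A: "A > 0" using powr_integral_pos[of 1] nonneg by (simp add: A_def)
  have C: "C > 0" using powr_integral_pos[OF p] by (simp add: C_def)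
  have pt: "(f x)\<^sup>2 / (A powr a * C powr b) \<le> a * (f x / A) + b * (f x powr p / C)" for x
  proof (cases "f x = 0")
    case False
    then have fx: "f x > 0" using nonneg[of x] by simp
    have "(f x)\<^sup>2 = f x powr a * (f x powr p) powr b"
      using fx ab(4) by (simp add: powr_powr powr_add[symmetric])
    then have "(f x)\<^sup>2 / (A powr a * C powr b) = (f x / A) powr a * (f x powr p / C) powr b"
      using fx A C by (simp add: powr_divide)
    also have "\<dots> \<le> a * (f x / A) + b * (f x powr p / C)"
      using fx A C ab by (intro Youngs_inequality_0) auto
    finally show ?thesis .
  qed (use A C ab in auto)
  have "autocorr 0 / (A powr a * C powr b) = (\<integral>x. (f x)\<^sup>2 / (A powr a * C powr b) \<partial>lborel)"
    by (simp add: autocorr_0)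
  also have "\<dots> \<le> (\<integral>x. a * (f x / A) + b * (f x powr p / C) \<partial>lborel)"
    by (intro integral_mono pt Bochner_Integration.integrable_add integrable_mult_right integrable_divide
        sq_integrable integrable powr_integrable p)
  also have "\<dots> = a * (A / A) + b * (C / C)"
    using integrable powr_integrable[OF p] by (simp add: A_def[symmetric] C_def[symmetric])
  also have "\<dots> = 1" using A C ab by simp
  finally show ?thesis using A C unfolding A_def[symmetric] C_def[symmetric] by (simp add: divide_le_eq)
qed

lemma Lp_interpolation:
  fixes n :: real
  defines "n \<equiv> real DIM('a)"
  assumes \<alpha>: "0 < \<alpha>" "\<alpha> < 1/2"
  shows "autocorr 0 powr (1 + 2 * \<alpha> / n) * (\<integral>x. f x \<partial>lborel) powr (- 4 * \<alpha> / n)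
    \<le> Lp_norm (2 * n / (n - 2 * \<alpha>)) f powr 2"
proof -
  have n: "n \<ge> 1" using DIM_positive[where 'a='a] by (simp add: n_def Suc_leI)
  define p where "p = 2 * n / (n - 2 * \<alpha>)"
  have p: "p \<ge> 1" using n \<alpha> by (simp add: p_def field_simps)
  define A where "A = (\<integral>x. f x \<partial>lborel)"
  define C where "C = (\<integral>x. f x powr p \<partial>lborel)"
  have A: "A > 0" using powr_integral_pos[of 1] nonneg by (simp add: A_def)
  have C: "C > 0" using powr_integral_pos[OF p] by (simp add: C_def)
  \<comment> \<open>The solution of \<open>a + b = 1\<close> and \<open>a + p * b = 2\<close> for
    the exponent \<open>p\<close> at hand. The later power \<open>(n + 2 * \<alpha>) / n\<close>
    clears the common denominator of \<open>a\<close> and \<open>b\<close>.\<close>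
  define a where "a = 4 * \<alpha> / (n + 2 * \<alpha>)"
  define b where "b = (n - 2 * \<alpha>) / (n + 2 * \<alpha>)"
  have pos: "n + 2 * \<alpha> > 0" "n - 2 * \<alpha> > 0" using n \<alpha> by auto
  have ab: "0 \<le> a" "0 \<le> b" "a + b = 1" "a + p * b = 2"
    using pos \<alpha> n by (auto simp: a_def b_def p_def add_divide_distrib[symmetric]) (simp add: field_simps)
  have "autocorr 0 \<le> A powr a * C powr b"
    using interpolation[OF p ab] by (simp add: A_def C_def)
  then have "autocorr 0 powr ((n + 2 * \<alpha>) / n) \<le> (A powr a * C powr b) powr ((n + 2 * \<alpha>) / n)"
    using pos n autocorr_nonneg[of 0] by (intro powr_mono2) auto
  also have "\<dots> = A powr (4 * \<alpha> / n) * C powr ((n - 2 * \<alpha>) / n)"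
    using pos A C by (simp add: powr_mult powr_powr a_def b_def)
  finally have "autocorr 0 powr ((n + 2 * \<alpha>) / n) * A powr (- 4 * \<alpha> / n)
      \<le> A powr (4 * \<alpha> / n) * C powr ((n - 2 * \<alpha>) / n) * A powr (- 4 * \<alpha> / n)"
    by (intro mult_right_mono) auto
  also have "\<dots> = C powr ((n - 2 * \<alpha>) / n) * (A powr (4 * \<alpha> / n) * A powr (- 4 * \<alpha> / n))" by simp
  also have "A powr (4 * \<alpha> / n) * A powr (- 4 * \<alpha> / n) = 1"
    using A by (simp add: powr_add[symmetric])
  also have "C powr ((n - 2 * \<alpha>) / n) = (C powr (1 / p)) powr 2"
  proof -
    have "1 / p * 2 = (n - 2 * \<alpha>) / n" using pos n by (simp add: p_def field_simps)
    then show ?thesis by (simp only: powr_powr)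
  qed
  also have "C powr (1 / p) = Lp_norm p f"
    using Lp_norm_eq[OF p] by (simp add: C_def)
  finally show ?thesis
    using n by (simp add: p_def A_def add_divide_distrib)
qed

lemma Lp_norm_1: "Lp_norm 1 f = (\<integral>x. f x \<partial>lborel)"
proof -
  have "(\<integral>x. f x powr 1 \<partial>lborel) > 0" by (rule powr_integral_pos) simp
  then show ?thesis using Lp_norm_eq[of 1] nonneg by simp
qed

lemma Lp_norm_2: "Lp_norm 2 f = autocorr 0 powr (1 / 2)"
  using Lp_norm_eq[of 2] nonneg by (simp add: autocorr_0 powr_numeral)

lemma Lp_norm_2_powr:
  "Lp_norm 2 f powr (2 + 4 * \<alpha> / n) = autocorr 0 powr (1 + 2 * \<alpha> / n)"
  unfolding Lp_norm_2 by (simp add: powr_powr add_divide_distrib)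

section \<open>From the comparison of integrals to the constants of the theorem\<close>

context
  fixes \<alpha> n :: real
  assumes \<alpha>: "0 < \<alpha>" "\<alpha> < 1/2"
  defines "n \<equiv> real DIM('a)"
begin

text \<open>\<open>X\<close> is what \<open>Gamma (n + 1)\<close> times the volume equals in the
  case of equality. The power \<open>- 2 * \<alpha> / n\<close> inverts the exponent on
  \<open>kappa\<close>, and \<open>autocorr 0 * kappa \<alpha>\<close> is the constant
  \<open>\<alpha> / Gamma (1 - 2 * \<alpha>)\<close>.\<close>

lemma volume_algebra:
  defines "X \<equiv> (\<integral>x. f x \<partial>lborel)\<^sup>2 / (autocorr 0 * kappa \<alpha> powr (- n / (2 * \<alpha>)))"
  shows "\<alpha> / Gamma (1 - 2 * \<alpha>) * X powr (- 2 * \<alpha> / n)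
    = autocorr 0 powr (1 + 2 * \<alpha> / n) * (\<integral>x. f x \<partial>lborel) powr (- 4 * \<alpha> / n)" and "X > 0"
proof -
  have n: "n > 0" using DIM_positive[where 'a='a] by (simp add: n_def)
  have A: "(\<integral>x. f x \<partial>lborel) > 0" (is "?A > 0") using powr_integral_pos[of 1] nonneg by simp
  have k: "kappa \<alpha> > 0" by (rule kappa_pos[OF \<alpha>])
  have G: "Gamma (1 - 2 * \<alpha>) > 0" using \<alpha> by (intro Gamma_real_pos) simp
  show "X > 0" unfolding X_def using A k autocorr_0_pos by simp
  have "X powr (- 2 * \<alpha> / n) = (?A\<^sup>2) powr (- 2 * \<alpha> / n) / (autocorr 0 powr (- 2 * \<alpha> / n) * (kappa \<alpha> powr (- n / (2 * \<alpha>))) powr (- 2 * \<alpha> / n))"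
    unfolding X_def using A k autocorr_0_pos by (simp add: powr_divide powr_mult)
  also have "(kappa \<alpha> powr (- n / (2 * \<alpha>))) powr (- 2 * \<alpha> / n) = kappa \<alpha>"
    using n \<alpha> k by (simp add: powr_powr)
  also have "(?A\<^sup>2) powr (- 2 * \<alpha> / n) = ?A powr (- 4 * \<alpha> / n)"
    using A by (simp add: powr_powr flip: powr_numeral)
  finally have "X powr (- 2 * \<alpha> / n) = ?A powr (- 4 * \<alpha> / n) * autocorr 0 powr (2 * \<alpha> / n) / kappa \<alpha>"
    by (simp add: powr_minus field_simps)
  moreover have "\<alpha> / Gamma (1 - 2 * \<alpha>) = autocorr 0 * kappa \<alpha>"
    unfolding kappa_def[OF \<alpha>] using autocorr_0_pos by simp
  ultimately show "\<alpha> / Gamma (1 - 2 * \<alpha>) * X powr (- 2 * \<alpha> / n) = autocorr 0 powr (1 + 2 * \<alpha> / n) * ?A powr (- 4 * \<alpha> / n)"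
    using k autocorr_0_pos by (simp add: powr_add)
qed

lemma L1_sq_ennreal: "(\<integral>\<^sup>+x. ennreal (f x) \<partial>lborel)\<^sup>2 = ennreal ((\<integral>x. f x \<partial>lborel)\<^sup>2)"
  using nonneg by (subst nn_integral_eq_integral[OF integrable]) (auto simp: ennreal_power integral_nonneg_AE)

text \<open>Zero volume would force the integral of \<open>f\<close> to vanish. Positivity matters
  for the meaning of the result, since \<open>powr\<close> evaluates a negative power of 0 to 0
  rather than to infinity.\<close>

lemma volume_pos: "0 < emeasure lborel (Pi_star \<alpha> f)"
proof (rule ccontr)
  assume "\<not> ?thesis"
  then have "ennreal ((\<integral>x. f x \<partial>lborel)\<^sup>2) \<le> 0"
    using L1_sq_le_volume[OF \<alpha>] by (simp add: L1_sq_ennreal)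
  moreover have "(\<integral>x. f x \<partial>lborel) > 0" using powr_integral_pos[of 1] nonneg by simp
  ultimately show False by (simp add: ennreal_eq_0_iff)
qed

lemma volume_power_form:
  fixes P :: real
  assumes "P \<ge> 0"
  defines "X \<equiv> (\<integral>x. f x \<partial>lborel)\<^sup>2 / (autocorr 0 * kappa \<alpha> powr (- n / (2 * \<alpha>)))"
  shows "\<alpha> / (Gamma (n + 1) powr (2 * \<alpha> / n) * Gamma (1 - 2 * \<alpha>)) * P powr (- 2 * \<alpha> / n)
      = \<alpha> / Gamma (1 - 2 * \<alpha>) * (Gamma (n + 1) * P) powr (- 2 * \<alpha> / n)"
    and "(\<integral>x. f x \<partial>lborel)\<^sup>2 \<le> ratio \<alpha> * P \<longleftrightarrow> X \<le> Gamma (n + 1) * P"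
    and "(\<integral>x. f x \<partial>lborel)\<^sup>2 = ratio \<alpha> * P \<longleftrightarrow> X = Gamma (n + 1) * P"
proof -
  have "n > 0" using DIM_positive[where 'a='a] by (simp add: n_def)
  define g where "g = Gamma (n + 1)"
  have g: "g > 0" unfolding g_def using \<open>n > 0\<close> by (intro Gamma_real_pos) simp
  show "\<alpha> / (Gamma (n + 1) powr (2 * \<alpha> / n) * Gamma (1 - 2 * \<alpha>)) * P powr (- 2 * \<alpha> / n)
      = \<alpha> / Gamma (1 - 2 * \<alpha>) * (Gamma (n + 1) * P) powr (- 2 * \<alpha> / n)"
    unfolding g_def[symmetric] using g \<open>P \<ge> 0\<close> by (simp add: powr_mult powr_minus divide_inverse)
  define q where "q = autocorr 0 * kappa \<alpha> powr (- n / (2 * \<alpha>))"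
  have q: "q > 0" unfolding q_def using kappa_pos[OF \<alpha>] autocorr_0_pos by simp
  have R: "ratio \<alpha> = q * g"
    by (simp add: ratio_def[OF \<alpha>] n_def q_def g_def)
  show "(\<integral>x. f x \<partial>lborel)\<^sup>2 \<le> ratio \<alpha> * P \<longleftrightarrow> X \<le> Gamma (n + 1) * P"
    "(\<integral>x. f x \<partial>lborel)\<^sup>2 = ratio \<alpha> * P \<longleftrightarrow> X = Gamma (n + 1) * P"
    unfolding X_def R q_def[symmetric] g_def[symmetric] using q by (simp_all add: field_simps)
qed

lemma volume_inequality:
  "\<alpha> / (Gamma (n + 1) powr (2 * \<alpha> / n) * Gamma (1 - 2 * \<alpha>))
     * enn2real (emeasure lborel (Pi_star \<alpha> f)) powr (- 2 * \<alpha> / n)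
   \<le> autocorr 0 powr (1 + 2 * \<alpha> / n) * (\<integral>x. f x \<partial>lborel) powr (- 4 * \<alpha> / n)"
proof -
  have n: "n > 0" using DIM_positive[where 'a='a] by (simp add: n_def)
  have c: "\<alpha> / Gamma (1 - 2 * \<alpha>) > 0" using \<alpha> by (intro divide_pos_pos Gamma_real_pos) auto
  define P where "P = enn2real (emeasure lborel (Pi_star \<alpha> f))"
  show ?thesis
  proof (cases "P = 0")
    \<comment> \<open>\<open>enn2real\<close> sends an infinite volume to 0, and \<open>powr\<close>
      sends this to 0 again, so the left side vanishes, as it should for infinite volume.\<close>
    case True
    then show ?thesis unfolding P_def[symmetric] by simp
  next
    case False
    then have P: "emeasure lborel (Pi_star \<alpha> f) = ennreal P" "P > 0"
      unfolding P_def by (cases "emeasure lborel (Pi_star \<alpha> f)"; simp add: less_le)+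
    have "ennreal ((\<integral>x. f x \<partial>lborel)\<^sup>2) \<le> ennreal (ratio \<alpha> * P)"
      using L1_sq_le_volume[OF \<alpha>] ratio_pos[OF \<alpha>] P by (simp add: L1_sq_ennreal ennreal_mult)
    then have "(\<integral>x. f x \<partial>lborel)\<^sup>2 \<le> ratio \<alpha> * P"
      using ratio_pos[OF \<alpha>] P by (subst (asm) ennreal_le_iff) auto
    note le = this[unfolded volume_power_form(2)[OF less_imp_le[OF P(2)]]]
    \<comment> \<open>The exponent is negative, so the lower bound for the volume becomes an upper
      bound.\<close>
    have "(Gamma (n + 1) * P) powr (- 2 * \<alpha> / n)
        \<le> ((\<integral>x. f x \<partial>lborel)\<^sup>2 / (autocorr 0 * kappa \<alpha> powr (- n / (2 * \<alpha>)))) powr (- 2 * \<alpha> / n)"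
      using n \<alpha> by (intro powr_mono2' le volume_algebra(2)) auto
    then show ?thesis
      unfolding P_def[symmetric] volume_power_form(1)[OF less_imp_le[OF P(2)]] volume_algebra(1)[symmetric]
      using c by (intro mult_left_mono) auto
  qed
qed

lemma volume_equality:
  assumes "\<And>\<xi>. norm \<xi> = 1 \<Longrightarrow> \<exists>c\<ge>0. \<forall>t>0. autocorr (t *\<^sub>R \<xi>) = autocorr 0 * exp (- c * t)"
  shows "\<alpha> / (Gamma (n + 1) powr (2 * \<alpha> / n) * Gamma (1 - 2 * \<alpha>))
     * enn2real (emeasure lborel (Pi_star \<alpha> f)) powr (- 2 * \<alpha> / n)
   = autocorr 0 powr (1 + 2 * \<alpha> / n) * (\<integral>x. f x \<partial>lborel) powr (- 4 * \<alpha> / n)"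
proof -
  have e: "ennreal ((\<integral>x. f x \<partial>lborel)\<^sup>2) = ennreal (ratio \<alpha>) * emeasure lborel (Pi_star \<alpha> f)"
    using L1_sq_eq_volume[OF \<alpha> assms] by (simp add: L1_sq_ennreal)
  have "emeasure lborel (Pi_star \<alpha> f) \<noteq> \<infinity>"
  proof
    assume "emeasure lborel (Pi_star \<alpha> f) = \<infinity>"
    then show False using e ratio_pos[OF \<alpha>] by (simp add: ennreal_mult_top)
  qed
  then obtain P where P: "emeasure lborel (Pi_star \<alpha> f) = ennreal P" "P \<ge> 0"
    by (cases "emeasure lborel (Pi_star \<alpha> f)") auto
  have "(\<integral>x. f x \<partial>lborel)\<^sup>2 = ratio \<alpha> * P"
    using e ratio_pos[OF \<alpha>] P by (simp add: ennreal_mult[symmetric])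
  note eq = this[unfolded volume_power_form(3)[OF P(2)]]
  have "enn2real (emeasure lborel (Pi_star \<alpha> f)) = P" using P by simp
  then show ?thesis
    by (simp only: volume_power_form(1)[OF P(2)] volume_algebra(1)[symmetric] eq)
qed

end
end

section \<open>Invariance under changes on null sets\<close>

lemma AE_lebesgue_shift:
  fixes y :: "'a::euclidean_space"
  assumes "AE x in lebesgue. P x"
  shows "AE x in lebesgue. P (x + y)"
proof -
  have "AE x in lborel. P x" using assms by (simp add: AE_completion_iff)
  then obtain N where N: "N \<in> null_sets lborel" "{x. \<not> P x} \<subseteq> N"
    by (auto elim!: AE_E simp: null_sets_def)
  then have "emeasure lborel {x. x - (- y) \<in> N} = 0"
    by (subst emeasure_lborel_shift) auto
  moreover have "{x. x - (- y) \<in> N} \<in> sets borel"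
  proof -
    have [measurable]: "N \<in> sets borel" using N by auto
    show ?thesis by measurable
  qed
  ultimately have "{x. x - (- y) \<in> N} \<in> null_sets lborel" by (intro null_setsI) auto
  from AE_not_in[OF this] have "AE x in lborel. P (x + y)"
    by eventually_elim (use N in auto)
  then show ?thesis by (simp add: AE_completion_iff)
qed

lemma Lp_norm_cong_AE:
  assumes "AE x in lebesgue. f x = g x"
  shows "Lp_norm p f = Lp_norm p g"
proof -
  have "(\<integral>\<^sup>+x. ennreal (\<bar>f x\<bar> powr p) \<partial>lebesgue) = (\<integral>\<^sup>+x. ennreal (\<bar>g x\<bar> powr p) \<partial>lebesgue)"
    by (rule nn_integral_cong_AE) (use assms in eventually_elim, simp)
  then show ?thesis by (simp only: Lp_norm_def)
qed

lemma Pi_star_cong_AE: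
  fixes f g :: "'a::euclidean_space \<Rightarrow> real"
  assumes ae: "AE x in lebesgue. f x = g x"
  shows "Pi_star \<alpha> f = Pi_star \<alpha> g"
proof -
  have "(\<integral>\<^sup>+x. ennreal ((f (x + y) - f x)\<^sup>2) \<partial>lebesgue) = (\<integral>\<^sup>+x. ennreal ((g (x + y) - g x)\<^sup>2) \<partial>lebesgue)" for y
    by (rule nn_integral_cong_AE) (use ae AE_lebesgue_shift[OF ae, of y] in eventually_elim, simp)
  then have "Pi_integral \<alpha> f = Pi_integral \<alpha> g" by (simp add: Pi_integral_def fun_eq_iff)
  then show ?thesis by (simp add: Pi_star_def Pi_radial_def)
qed

lemma nontrivial_open_part:
  fixes f :: "'a::euclidean_space \<Rightarrow> real"
  assumes "log_concave f" "integrable lebesgue (\<lambda>x. (f x)\<^sup>2)" "interior {x. f x > 0} \<noteq> {}"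
  shows "nontrivial_log_concave (open_part f) (interior {x. f x > 0})"
proof
  show "log_concave (open_part f)" by (rule open_part_log_concave[OF assms(1)])
  show m: "open_part f \<in> borel_measurable borel" by (rule open_part_measurable[OF assms(1)])
  show "convex (interior {x. f x > 0})" by (intro convex_interior log_concave_convex_support assms)
  show "isCont (open_part f) x" if "x \<notin> frontier (interior {x. f x > 0})" for x
    using open_part_isCont[OF assms(1) that] .
  show "open_part f x > 0" if "x \<in> interior {x. f x > 0}" for x
    using that interior_subset[of "{x. f x > 0}"] by (auto simp: open_part_def)
  have "(\<integral>\<^sup>+x. ennreal (norm ((open_part f x)\<^sup>2)) \<partial>lebesgue) = (\<integral>\<^sup>+x. ennreal (norm ((f x)\<^sup>2)) \<partial>lebesgue)"
    by (rule nn_integral_cong_AE) (use open_part_AE_eq[OF assms(1)] in eventually_elim, simp)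
  also have "\<dots> < \<infinity>" using assms(2) by (simp add: integrable_iff_bounded)
  finally show "integrable lborel (\<lambda>x. (open_part f x)\<^sup>2)"
    using m by (simp add: integrable_iff_bounded nn_integral_completion)
qed (use assms in auto)

section \<open>Autocorrelation of the exponential of a simplex gauge\<close>

context simplex_coords begin

lemma cone_exp_measurable [measurable]: "cone_exp a \<in> borel_measurable borel"
proof -
  have [measurable]: "(\<lambda>x. coord x b) \<in> borel_measurable borel" for b
    by (intro borel_measurable_continuous_onI linear_continuous_on linear_conv_bounded_linear[THEN iffD1] linearI)
      (auto simp: coord_add coord_scale)
  have [measurable]: "csum \<in> borel_measurable borel" unfolding csum_def[abs_def] by measurable
  have [measurable]: "Measurable.pred borel (\<lambda>x. \<forall>b\<in>B. 0 \<le> coord x b)"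
    using fin by measurable
  show ?thesis unfolding cone_exp_def[abs_def] by measurable
qed

text \<open>Shifting the variable by \<open>x0 + negpart y\<close> moves the overlap of the two
  cones back to the cone at the origin, where the dependence on \<open>y\<close> is a constant
  factor.\<close>

lemma cone_exp_autocorr:
  assumes "a \<ge> 0"
  shows "(\<integral>\<^sup>+x. ennreal (cone_exp a (x - x0) * cone_exp a (x + y - x0)) \<partial>lborel)
    = ennreal (exp (- (csum y + 2 * csum (negpart y)))) * (\<integral>\<^sup>+x. ennreal (cone_exp a (x - x0) * cone_exp a (x - x0)) \<partial>lborel)"
proof -
  have nn: "cone_exp a z \<ge> 0" for z using assms by (simp add: cone_exp_def)
  have "(\<integral>\<^sup>+x. ennreal (cone_exp a (x - x0) * cone_exp a (x + y - x0)) \<partial>lborel)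
      = (\<integral>\<^sup>+x. ennreal (cone_exp a (x + (x0 + negpart y) - x0) * cone_exp a (x + (x0 + negpart y) + y - x0)) \<partial>lborel)"
    by (rule nn_integral_lborel_shift[symmetric]) measurable
  also have "\<dots> = (\<integral>\<^sup>+x. ennreal (exp (- (csum y + 2 * csum (negpart y)))) * ennreal (cone_exp a x * cone_exp a x) \<partial>lborel)"
  proof (rule nn_integral_cong)
    fix x
    have "x + (x0 + negpart y) - x0 = x + negpart y" "x + (x0 + negpart y) + y - x0 = x + negpart y + y"
      by (auto simp: algebra_simps)
    then show "ennreal (cone_exp a (x + (x0 + negpart y) - x0) * cone_exp a (x + (x0 + negpart y) + y - x0))
        = ennreal (exp (- (csum y + 2 * csum (negpart y)))) * ennreal (cone_exp a x * cone_exp a x)"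
      by (simp only: cone_exp_product) (simp add: ennreal_mult nn)
  qed
  also have "\<dots> = ennreal (exp (- (csum y + 2 * csum (negpart y)))) * (\<integral>\<^sup>+x. ennreal (cone_exp a x * cone_exp a x) \<partial>lborel)"
    by (rule nn_integral_cmult) measurable
  also have "(\<integral>\<^sup>+x. ennreal (cone_exp a x * cone_exp a x) \<partial>lborel)
      = (\<integral>\<^sup>+x. ennreal (cone_exp a (x + (- x0)) * cone_exp a (x + (- x0))) \<partial>lborel)"
    by (rule nn_integral_lborel_shift[symmetric]) measurable
  finally show ?thesis by simp
qed

end

text \<open>The rate is the sum of the absolute values of the coordinates of \<xi> in the edge basis
  of the simplex. It is positively homogeneous, so the exponent is linear along each ray.\<close>

lemma (in nontrivial_log_concave) autocorr_simplex:
  fixes \<Delta> :: "'a set"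
  assumes \<Delta>: "DIM('a) simplex \<Delta>" "0 extreme_point_of \<Delta>" and a: "a \<ge> 0"
    and f: "AE x in lebesgue. f x = (if gauge_fn \<Delta> (x - x0) = \<infinity> then 0
                        else a * exp (- real_of_ereal (gauge_fn \<Delta> (x - x0))))"
  shows "\<exists>c\<ge>0. \<forall>t>0. autocorr (t *\<^sub>R \<xi>) = autocorr 0 * exp (- c * t)"
proof -
  obtain B where B: "finite B" "independent B" "span B = UNIV" "\<Delta> = convex hull (insert 0 B)" "0 \<notin> B"
    using simplex_at_origin_basis[OF \<Delta>] .
  interpret simplex_coords B using B by unfold_locales
  have f': "AE x in lebesgue. f x = cone_exp a (x - x0)"
    using f by eventually_elim (simp add: B(4) gauge_fn_simplex cone_exp_def)
  have ac: "ennreal (autocorr y) = (\<integral>\<^sup>+x. ennreal (cone_exp a (x - x0) * cone_exp a (x + y - x0)) \<partial>lborel)" for y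
  proof -
    have "ennreal (autocorr y) = (\<integral>\<^sup>+x. ennreal (f x * f (x + y)) \<partial>lebesgue)"
      by (simp add: nn_integral_autocorr nn_integral_completion)
    also have "\<dots> = (\<integral>\<^sup>+x. ennreal (cone_exp a (x - x0) * cone_exp a (x + y - x0)) \<partial>lebesgue)"
      by (rule nn_integral_cong_AE) (use f' AE_lebesgue_shift[OF f', of y] in eventually_elim, simp)
    finally show ?thesis by (simp only: nn_integral_completion)
  qed
  have e: "autocorr y = autocorr 0 * exp (- (csum y + 2 * csum (negpart y)))" for y
  proof -
    have "ennreal (autocorr y) = ennreal (exp (- (csum y + 2 * csum (negpart y)))) * ennreal (autocorr 0)"
      unfolding ac using cone_exp_autocorr[OF a, of x0 y] by (simp only: add_0_right)
    also have "\<dots> = ennreal (autocorr 0 * exp (- (csum y + 2 * csum (negpart y))))"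
      using autocorr_nonneg[of 0] by (subst mult.commute) (simp add: ennreal_mult)
    finally show ?thesis using autocorr_nonneg by (subst (asm) ennreal_inj) auto
  qed
  show ?thesis
  proof (intro exI[of _ "csum \<xi> + 2 * csum (negpart \<xi>)"] conjI allI impI csum_negpart)
    fix t :: real assume "t > 0"
    then have "csum (t *\<^sub>R \<xi>) + 2 * csum (negpart (t *\<^sub>R \<xi>)) = (csum \<xi> + 2 * csum (negpart \<xi>)) * t"
      by (simp add: csum_scale negpart_scale algebra_simps)
    then show "autocorr (t *\<^sub>R \<xi>) = autocorr 0 * exp (- (csum \<xi> + 2 * csum (negpart \<xi>)) * t)"
      using e[of "t *\<^sub>R \<xi>"] by (simp only: mult_minus_left)
  qed
qed

theorem theorem20:
  fixes f :: "'a::euclidean_space \<Rightarrow> real" and \<alpha> :: real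
  defines "n \<equiv> real DIM('a)"
  assumes "0 < \<alpha>" and "\<alpha> < 1/2"
    and "f \<in> borel_measurable lebesgue"
    and "integrable lebesgue (\<lambda>x. (f x)\<^sup>2)"
    and "log_concave f"
  shows "0 < emeasure lebesgue (Pi_star \<alpha> f)
      \<and> \<alpha> / (Gamma (n + 1) powr (2 * \<alpha> / n) * Gamma (1 - 2 * \<alpha>))
          * enn2real (emeasure lebesgue (Pi_star \<alpha> f)) powr (- 2 * \<alpha> / n)
        \<le> Lp_norm 2 f powr (2 + 4 * \<alpha> / n) * Lp_norm 1 f powr (- 4 * \<alpha> / n)
      \<and> Lp_norm 2 f powr (2 + 4 * \<alpha> / n) * Lp_norm 1 f powr (- 4 * \<alpha> / n)
        \<le> Lp_norm (2 * n / (n - 2 * \<alpha>)) f powr 2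
      \<and> (\<forall>a x0 \<Delta>. a \<ge> 0 \<and> DIM('a) simplex \<Delta> \<and> 0 extreme_point_of \<Delta> \<and>
           (\<forall>x. f x = (if gauge_fn \<Delta> (x - x0) = \<infinity> then 0
                        else a * exp (- real_of_ereal (gauge_fn \<Delta> (x - x0)))))
         \<longrightarrow> \<alpha> / (Gamma (n + 1) powr (2 * \<alpha> / n) * Gamma (1 - 2 * \<alpha>))
               * enn2real (emeasure lebesgue (Pi_star \<alpha> f)) powr (- 2 * \<alpha> / n)
             = Lp_norm 2 f powr (2 + 4 * \<alpha> / n) * Lp_norm 1 f powr (- 4 * \<alpha> / n))"
proof (cases "interior {x. f x > 0} = {}")
  \<comment> \<open>Here \<open>f\<close> vanishes almost everywhere: all its norms are 0, and
    \<open>Pi_star\<close> is the whole space. Its infinite volume becomes 0 under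
    \<open>enn2real\<close>, and all sides reduce to 0.\<close>
  case True
  then have "open_part f = (\<lambda>_. 0)" by (simp add: open_part_def fun_eq_iff)
  then have ae: "AE x in lebesgue. f x = 0"
    using open_part_AE_eq[OF assms(6)] by simp
  have L: "Lp_norm p f = 0" for p
    unfolding Lp_norm_cong_AE[OF ae] by (simp add: Lp_norm_def)
  have "Pi_star \<alpha> f = UNIV"
    unfolding Pi_star_cong_AE[OF ae] by (simp add: Pi_star_def Pi_radial_def Pi_integral_def)
  then show ?thesis by (simp add: L)
next
  case False
  interpret nontrivial_log_concave "open_part f" "interior {x. f x > 0}"
    by (rule nontrivial_open_part[OF assms(6,5) False])
  have ae: "AE x in lebesgue. f x = open_part f x"
    using open_part_AE_eq[OF assms(6)] by eventually_elim simp
  note \<alpha> = assms(2,3)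
  have em: "emeasure lebesgue (Pi_star \<alpha> f) = emeasure lborel (Pi_star \<alpha> (open_part f))"
    unfolding Pi_star_cong_AE[OF ae] using Pi_star_borel[OF \<alpha>] by simp
  have mid: "Lp_norm 2 f powr (2 + 4 * \<alpha> / n) * Lp_norm 1 f powr (- 4 * \<alpha> / n)
      = autocorr 0 powr (1 + 2 * \<alpha> / n) * (\<integral>x. open_part f x \<partial>lborel) powr (- 4 * \<alpha> / n)"
    unfolding Lp_norm_cong_AE[OF ae] Lp_norm_2_powr Lp_norm_1 ..
  show ?thesis
  proof (intro conjI allI impI)
    show "0 < emeasure lebesgue (Pi_star \<alpha> f)"
      unfolding em by (rule volume_pos[OF \<alpha>])
    show "\<alpha> / (Gamma (n + 1) powr (2 * \<alpha> / n) * Gamma (1 - 2 * \<alpha>))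
          * enn2real (emeasure lebesgue (Pi_star \<alpha> f)) powr (- 2 * \<alpha> / n)
        \<le> Lp_norm 2 f powr (2 + 4 * \<alpha> / n) * Lp_norm 1 f powr (- 4 * \<alpha> / n)"
      unfolding em mid[unfolded n_def] n_def by (rule volume_inequality[OF \<alpha>])
    show "Lp_norm 2 f powr (2 + 4 * \<alpha> / n) * Lp_norm 1 f powr (- 4 * \<alpha> / n)
        \<le> Lp_norm (2 * n / (n - 2 * \<alpha>)) f powr 2"
      unfolding mid[unfolded n_def] Lp_norm_cong_AE[OF ae, of "2 * real DIM('a) / (real DIM('a) - 2 * \<alpha>)"] n_def by (rule Lp_interpolation[OF \<alpha>])
  next
    fix a x0 \<Delta>
    assume *: "a \<ge> 0 \<and> DIM('a) simplex \<Delta> \<and> 0 extreme_point_of \<Delta> \<and>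
           (\<forall>x. f x = (if gauge_fn \<Delta> (x - x0) = \<infinity> then 0
                        else a * exp (- real_of_ereal (gauge_fn \<Delta> (x - x0)))))"
    \<comment> \<open>\<open>open_part f\<close> inherits the pointwise formula for \<open>f\<close>
      only almost everywhere, which is the form in which \<open>autocorr_simplex\<close> takes
      it.\<close>
    have "AE x in lebesgue. open_part f x = (if gauge_fn \<Delta> (x - x0) = \<infinity> then 0
                        else a * exp (- real_of_ereal (gauge_fn \<Delta> (x - x0))))"
      using open_part_AE_eq[OF assms(6)] by eventually_elim (use * in auto)
    then have "\<exists>c\<ge>0. \<forall>t>0. autocorr (t *\<^sub>R \<xi>) = autocorr 0 * exp (- c * t)" for \<xi>
      using * autocorr_simplex by blast
    then show "\<alpha> / (Gamma (n + 1) powr (2 * \<alpha> / n) * Gamma (1 - 2 * \<alpha>))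
               * enn2real (emeasure lebesgue (Pi_star \<alpha> f)) powr (- 2 * \<alpha> / n)
             = Lp_norm 2 f powr (2 + 4 * \<alpha> / n) * Lp_norm 1 f powr (- 4 * \<alpha> / n)"
      unfolding em mid[unfolded n_def] n_def by (rule volume_equality[OF \<alpha>])
  qed
qed

end
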